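(* (Fixed case) If the fixed Hilbert space conditions hold, then for each integer $j$ with $1\le j\le\operatorname{codim}(\mathcal K)$, the eigenvalue $\lambda_{-j}(\mathcal H,\mathbf a,\mathbf b^t)$ exists for all sufficiently large $t$ and increases to zero as $t\to\infty$. (Moving case) If the moving Hilbert space conditions hold, then for each integer $j$ with $1\le j\le\operatorname{codim}_{\mathcal H^\infty}(\mathcal K\cap\mathcal H^\infty)$, the eigenvalue $\lambda_{-j}(\mathcal H,\mathbf a,\mathbf b^t)$ exists for all sufficiently large $t$ and tends to zero as $t\to\infty$. (If the codimension is infinite, $j$ ranges over all positive integers.)
   Context: Let $(\mathcal H,\langle\cdot,\cdot\rangle)$ be a real Hilbert space with norm $\|\cdot\|$ and let $\mathbf a,\mathbf b,\mathbf c:\mathcal H\times\mathcal H\to\mathbb R$ be symmetric bilinear forms. Put $\mathbf b^t=\mathbf b-t\mathbf c$ for $t\in\mathbb R$, and $\mathbf A(u)=\mathbf a(u,u)$, $\mathbf C(u)=\mathbf c(u,u)$. Standing assumption: $\mathbf C\ge 0$ on $\mathcal H$ and $\mathbf C\not\equiv 0$. For a symmetric bilinear form $\mathbf f$ on $\mathcal H$, $\operatorname{Ker}(\mathbf f)=\{u\in\mathcal H:\mathbf f(u,v)=0\ \forall v\in\mathcal H\}$; put $\mathcal K=\operatorname{Ker}(\mathbf c)$. Conditions: (C1) there is $\gamma>0$ with $\gamma\|u\|^2\le\mathbf A(u)$ for all $u\in\mathcal H$. (C1$'$) $\dim\operatorname{Ker}(\mathbf a)<\infty$, $\mathbf A$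 is coercive on $\operatorname{Ker}(\mathbf a)^\perp$ (i.e. $\gamma\|u\|^2\le\mathbf A(u)$ there for some $\gamma>0$; $\perp$ with respect to $\langle\cdot,\cdot\rangle$), and $\operatorname{Ker}(\mathbf a)\cap\mathcal K=\{0\}$. (C2) $\mathbf a$ is continuous on $\mathcal H\times\mathcal H$. (C3) $\mathbf b$ and $\mathbf c$ are weakly sequentially continuous: $u^n\rightharpoonup u$, $v^n\rightharpoonup v$ imply $\mathbf b(u^n,v^n)\to\mathbf b(u,v)$ and $\mathbf c(u^n,v^n)\to\mathbf c(u,v)$. The fixed Hilbert space conditions are (C1),(C2),(C3); the moving Hilbert space conditions are (C1$'$),(C2),(C3). $\mathcal H^t=\{u\in\mathcal H:\mathbf b^t(u,w)=0\ \forall w\in\operatorname{Ker}(\mathbf a)\}$ and $\mathcal H^\infty=\liminf_{t\to\infty}\mathcal H^t=\bigcup_{s}\bigcap_{t>s}\mathcal H^t$, a closed subspace of $\mathcal H$. $\operatorname{codim}(\mathcal K)$ is the codimension of $\mathcal K$ in $\mathcal H$, and $\operatorname{codim}_{\mathcal H^\infty}(\mathcal K\cap\mathcal H^\infty)$ is the codimension of $\mathcal K\cap\mathcal H^\infty$ in $\mathcal H^\infty$. An eigenvalue of $(\mathcal H,\mathbf a,\mathbf b^t)$ is $\lambda\in\mathbb R$ for which there is $u\in\mathcal H\setminus\{0\}$ with $\mathbf a(u,v)=\lambda\,\mathbf b^t(u,v)$ for all $v\in\mathcal H$. $\lambda_{-j}(\mathcal H,\mathbf a,\mathbf b^t)$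 is the $j$-th negative eigenvalue in decreasing order ($\dots\le\lambda_{-2}\le\lambda_{-1}<0$), counted with multiplicity; it "exists" if there are at least $j$ negative eigenvalues. "Increases" is meant in the weak sense. *)

theory Defs
  imports "HOL-Analysis.Analysis" "HOL-Library.Extended_Nat"
begin

definition symmetric_bilinear :: "('a::real_vector \<Rightarrow> 'a \<Rightarrow> real) \<Rightarrow> bool" where
  "symmetric_bilinear f \<longleftrightarrow> bilinear f \<and> (\<forall>u v. f u v = f v u)"

definition form_ker :: "('a::real_vector \<Rightarrow> 'a \<Rightarrow> real) \<Rightarrow> 'a set" where
  "form_ker f = {u. \<forall>v. f u v = 0}"

definition pencil ::
  "('a::real_vector \<Rightarrow> 'a \<Rightarrow> real) \<Rightarrow> ('a \<Rightarrow> 'a \<Rightarrow> real) \<Rightarrow> real \<Rightarrow> ('a \<Rightarrow> 'a \<Rightarrow> real)" where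
  "pencil b c t = (\<lambda>u v. b u v - t * c u v)"

(* HOL's "dim" is 0 on infinite-dimensional spaces, hence dimensions in enat. *)
definition edim :: "'a::real_vector set \<Rightarrow> enat" where
  "edim V = (SUP B\<in>{B. finite B \<and> B \<subseteq> V \<and> independent B}. enat (card B))"

(* The images of the elements of B in the quotient by W are distinct and linearly independent. *)
definition independent_mod :: "'a::real_vector set \<Rightarrow> 'a set \<Rightarrow> bool" where
  "independent_mod W B \<longleftrightarrow> (\<forall>k. (\<Sum>x\<in>B. k x *\<^sub>R x) \<in> W \<longrightarrow> (\<forall>x\<in>B. k x = 0))"

(* For subspaces W \<subseteq> V, the dimension of V / W. *)
definition codim_in :: "'a::real_vector set \<Rightarrow> 'a set \<Rightarrow> enat" where
  "codim_in V W = (SUP B\<in>{B. finite B \<and> B \<subseteq> V \<and> independent_mod W B}. enat (card B))"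

definition weakly_converges :: "(nat \<Rightarrow> 'a::real_inner) \<Rightarrow> 'a \<Rightarrow> bool" where
  "weakly_converges x l \<longleftrightarrow> (\<forall>v. (\<lambda>n. x n \<bullet> v) \<longlonglongrightarrow> l \<bullet> v)"

definition weakly_seq_continuous :: "('a::real_inner \<Rightarrow> 'a \<Rightarrow> real) \<Rightarrow> bool" where
  "weakly_seq_continuous f \<longleftrightarrow>
     (\<forall>x y u v. weakly_converges x u \<and> weakly_converges y v \<longrightarrow> (\<lambda>n. f (x n) (y n)) \<longlonglongrightarrow> f u v)"

definition coercive_on :: "'a::real_inner set \<Rightarrow> ('a \<Rightarrow> 'a \<Rightarrow> real) \<Rightarrow> bool" where
  "coercive_on S f \<longleftrightarrow> (\<exists>\<gamma>>0. \<forall>u\<in>S. \<gamma> * (norm u)\<^sup>2 \<le> f u u)"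

definition fixed_conditions ::
  "('a::real_inner \<Rightarrow> 'a \<Rightarrow> real) \<Rightarrow> ('a \<Rightarrow> 'a \<Rightarrow> real) \<Rightarrow> ('a \<Rightarrow> 'a \<Rightarrow> real) \<Rightarrow> bool" where
  "fixed_conditions a b c \<longleftrightarrow>
     coercive_on UNIV a \<and>
     continuous_on UNIV (\<lambda>(u, v). a u v) \<and>
     weakly_seq_continuous b \<and> weakly_seq_continuous c"

definition moving_conditions ::
  "('a::real_inner \<Rightarrow> 'a \<Rightarrow> real) \<Rightarrow> ('a \<Rightarrow> 'a \<Rightarrow> real) \<Rightarrow> ('a \<Rightarrow> 'a \<Rightarrow> real) \<Rightarrow> bool" where
  "moving_conditions a b c \<longleftrightarrow>
     edim (form_ker a) < \<infinity> \<and>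
     coercive_on (orthogonal_comp (form_ker a)) a \<and>
     form_ker a \<inter> form_ker c = {0} \<and>
     continuous_on UNIV (\<lambda>(u, v). a u v) \<and>
     weakly_seq_continuous b \<and> weakly_seq_continuous c"

definition moving_space ::
  "('a::real_vector \<Rightarrow> 'a \<Rightarrow> real) \<Rightarrow> ('a \<Rightarrow> 'a \<Rightarrow> real) \<Rightarrow> ('a \<Rightarrow> 'a \<Rightarrow> real) \<Rightarrow> real \<Rightarrow> 'a set" where
  "moving_space a b c t = {u. \<forall>w\<in>form_ker a. pencil b c t u w = 0}"

definition limit_space ::
  "('a::real_vector \<Rightarrow> 'a \<Rightarrow> real) \<Rightarrow> ('a \<Rightarrow> 'a \<Rightarrow> real) \<Rightarrow> ('a \<Rightarrow> 'a \<Rightarrow> real) \<Rightarrow> 'a set" where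
  "limit_space a b c = (\<Union>s::real. \<Inter>t\<in>{s<..}. moving_space a b c t)"

definition eigenspace ::
  "('a::real_vector \<Rightarrow> 'a \<Rightarrow> real) \<Rightarrow> ('a \<Rightarrow> 'a \<Rightarrow> real) \<Rightarrow> real \<Rightarrow> 'a set" where
  "eigenspace a f \<mu> = {u. \<forall>v. a u v = \<mu> * f u v}"

definition is_eigenvalue ::
  "('a::real_vector \<Rightarrow> 'a \<Rightarrow> real) \<Rightarrow> ('a \<Rightarrow> 'a \<Rightarrow> real) \<Rightarrow> real \<Rightarrow> bool" where
  "is_eigenvalue a f \<mu> \<longleftrightarrow> (\<exists>u. u \<noteq> 0 \<and> u \<in> eigenspace a f \<mu>)"

(* Number of eigenvalues in I, with multiplicity.  The supremum over finite subsets is the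
   enat-valued sum, valid also when I contains infinitely many eigenvalues. *)
definition eigenvalue_count ::
  "('a::real_vector \<Rightarrow> 'a \<Rightarrow> real) \<Rightarrow> ('a \<Rightarrow> 'a \<Rightarrow> real) \<Rightarrow> real set \<Rightarrow> enat" where
  "eigenvalue_count a f I =
     (SUP F\<in>{F. finite F \<and> F \<subseteq> {\<mu>\<in>I. is_eigenvalue a f \<mu>}}. \<Sum>\<mu>\<in>F. edim (eigenspace a f \<mu>))"

(* In the decreasing enumeration of the negative eigenvalues, each repeated according to its
   multiplicity, the value \<mu> occupies exactly the positions j (counted from 1) satisfying the
   two inequalities below. *)
definition is_neg_eigenvalue ::
  "('a::real_vector \<Rightarrow> 'a \<Rightarrow> real) \<Rightarrow> ('a \<Rightarrow> 'a \<Rightarrow> real) \<Rightarrow> nat \<Rightarrow> real \<Rightarrow> bool" where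
  "is_neg_eigenvalue a f j \<mu> \<longleftrightarrow>
     \<mu> < 0 \<and> is_eigenvalue a f \<mu> \<and>
     eigenvalue_count a f {\<mu><..<0} < enat j \<and> enat j \<le> eigenvalue_count a f {\<mu>..<0}"

(* Besides the presence of at least j negative eigenvalues, this requires that the j-th one in
   decreasing order makes sense, i.e. that they do not accumulate before it. *)
definition neg_eigenvalue_exists ::
  "('a::real_vector \<Rightarrow> 'a \<Rightarrow> real) \<Rightarrow> ('a \<Rightarrow> 'a \<Rightarrow> real) \<Rightarrow> nat \<Rightarrow> bool" where
  "neg_eigenvalue_exists a f j \<longleftrightarrow> (\<exists>\<mu>. is_neg_eigenvalue a f j \<mu>)"

definition neg_eigenvalue ::
  "('a::real_vector \<Rightarrow> 'a \<Rightarrow> real) \<Rightarrow> ('a \<Rightarrow> 'a \<Rightarrow> real) \<Rightarrow> nat \<Rightarrow> real" where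
  "neg_eigenvalue a f j = (THE \<mu>. is_neg_eigenvalue a f j \<mu>)"

lemma eigenvalue_count_mono:
  "I \<subseteq> J \<Longrightarrow> eigenvalue_count a f I \<le> eigenvalue_count a f J"
  unfolding eigenvalue_count_def by (rule SUP_subset_mono) auto

lemma is_neg_eigenvalue_unique:
  assumes "is_neg_eigenvalue a f j \<nu>" "is_neg_eigenvalue a f j \<mu>"
  shows "\<nu> = \<mu>"
proof -
  have *: False if "x < y" "is_neg_eigenvalue a f j x" "is_neg_eigenvalue a f j y" for x y
  proof -
    have "enat j \<le> eigenvalue_count a f {y..<0}"
      using that by (simp add: is_neg_eigenvalue_def)
    also have "\<dots> \<le> eigenvalue_count a f {x<..<0}"
      using that(1) by (intro eigenvalue_count_mono) auto
    also have "\<dots> < enat j"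
      using that by (simp add: is_neg_eigenvalue_def)
    finally show False by simp
  qed
  show ?thesis
    using *[of \<nu> \<mu>] *[of \<mu> \<nu>] assms by (cases \<nu> \<mu> rule: linorder_cases) auto
qed

lemma neg_eigenvalue_eq: "is_neg_eigenvalue a f j \<mu> \<Longrightarrow> neg_eigenvalue a f j = \<mu>"
  unfolding neg_eigenvalue_def by (blast intro: is_neg_eigenvalue_unique)

lemma neg_eigenvalue_exists_count:
  assumes "neg_eigenvalue_exists a f j"
  shows "enat j \<le> eigenvalue_count a f {..<0}"
proof -
  obtain \<mu> where "enat j \<le> eigenvalue_count a f {\<mu>..<0}"
    using assms by (auto simp: neg_eigenvalue_exists_def is_neg_eigenvalue_def)
  also have "\<dots> \<le> eigenvalue_count a f {..<0}"
    by (rule eigenvalue_count_mono) auto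
  finally show ?thesis .
qed

end

theory Submission
  imports Defs "HOL-Complex_Analysis.Great_Picard"
begin

text \<open>Write \<open>f = b - t c\<close> and fix \<open>\<mu> < 0\<close>. On the span of the eigenspaces with eigenvalue in \<open>[\<mu>, 0)\<close> one has
  \<open>a \<le> \<mu> f\<close>, and this span has the largest dimension among the subspaces with this property that are
  \<open>f\<close>-orthogonal to \<open>Ker a\<close>: a larger one would contain a vector that is \<open>a\<close>-orthogonal to these
  eigenspaces, and minimizing \<open>f / a\<close> over the \<open>f\<close>-orthogonal complement of these eigenspaces and
  \<open>Ker a\<close> (weak compactness) would give one more eigenvector. So \<open>\<lambda>\<^sub>-\<^sub>j \<ge> \<mu>\<close> as soon as \<open>a \<le> \<mu> f\<close> on
  some \<open>j\<close>-dimensional subspace that is \<open>f\<close>-orthogonal to \<open>Ker a\<close>.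

  Since \<open>c \<ge> 0\<close>, the inequality persists when \<open>t\<close> grows, whence monotonicity in the fixed case. On a
  finite-dimensional subspace of the limit space complementary to \<open>Ker c\<close>, \<open>c\<close> is coercive, so the
  inequality holds there for every \<open>\<mu> < 0\<close> once \<open>t\<close> is large, whence existence and convergence to 0.
  The fixed case is the moving case with \<open>Ker a = 0\<close>.\<close>

text \<open>For small \<open>s\<close> the linear term dominates, so a nonzero \<open>q\<close>
  would allow a negative value. The point \<open>s = - q / P\<close> with
  \<open>P = \<bar>p\<bar> + 1\<close> shows this whatever the sign of \<open>p\<close>.\<close>

lemma quadratic_nonneg_linear_coeff_zero:
  fixes p q :: real
  assumes nonneg: "\<And>s. 0 \<le> s\<^sup>2 * p + 2 * s * q"
  shows "q = 0"
proof (rule ccontr)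
  assume "q \<noteq> 0"
  define P where "P = \<bar>p\<bar> + 1"
  have P: "P > 0" "p \<le> P" by (auto simp: P_def)
  have "0 \<le> (q / P)\<^sup>2 * p - 2 * (q / P) * q"
    using nonneg[of "- (q / P)"] by simp
  also have "\<dots> \<le> (q / P)\<^sup>2 * P - 2 * (q / P) * q"
    using P by (simp add: mult_left_mono)
  also have "\<dots> = - (q\<^sup>2 / P)"
    using P by (simp add: power2_eq_square)
  also have "\<dots> < 0"
    using P \<open>q \<noteq> 0\<close> by simp
  finally show False by simp
qed

section \<open>Weak compactness in Hilbert spaces\<close>

text \<open>The representing vector is the minimizer over \<open>M\<close> of
  \<open>J x = x \<bullet> x - 2 * L x\<close>. A minimizing sequence is Cauchy by the parallelogram
  identity, and the first variation of \<open>J\<close> at the limit is the representation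
  formula.\<close>

lemma riesz_on_closed_subspace:
  fixes M :: "'a::{real_inner,complete_space} set" and L :: "'a \<Rightarrow> real"
  assumes "closed M" "subspace M"
    and add: "\<And>x y. x \<in> M \<Longrightarrow> y \<in> M \<Longrightarrow> L (x + y) = L x + L y"
    and scale: "\<And>r x. x \<in> M \<Longrightarrow> L (r *\<^sub>R x) = r * L x"
    and bound: "\<And>x. x \<in> M \<Longrightarrow> \<bar>L x\<bar> \<le> C * norm x"
  obtains l where "l \<in> M" "\<And>x. x \<in> M \<Longrightarrow> L x = l \<bullet> x"
proof -
  define J where "J x = x \<bullet> x - 2 * L x" for x
  define m where "m = Inf (J ` M)"
  have "0 \<in> M" using \<open>subspace M\<close> by (rule subspace_0)
  have "- C\<^sup>2 \<le> J x" if "x \<in> M" for x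
  proof -
    have "0 \<le> (norm x - C)\<^sup>2" by simp
    also have "\<dots> = x \<bullet> x - 2 * (C * norm x) + C\<^sup>2"
      by (simp add: power2_diff power2_norm_eq_inner)
    also have "\<dots> \<le> J x + C\<^sup>2"
      using bound[OF that] by (simp add: J_def)
    finally show ?thesis by simp
  qed
  then have bdd: "bdd_below (J ` M)" by (rule bdd_belowI2)
  then have m_le: "m \<le> J x" if "x \<in> M" for x
    using that by (auto simp: m_def intro: cInf_lower)
  define \<delta> where "\<delta> n = inverse (real (Suc n))" for n
  have \<delta>_pos: "0 < \<delta> n" for n by (simp add: \<delta>_def)
  have "\<exists>x\<in>M. J x < m + \<delta> n" for n
    using cInf_lessD[of "J ` M" "m + \<delta> n"] \<open>0 \<in> M\<close> \<delta>_pos by (auto simp: m_def)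
  then obtain x where xM: "x n \<in> M" and xJ: "J (x n) < m + \<delta> n" for n
    by metis
  \<comment> \<open>The midpoint of two terms still costs at least \<open>m\<close>, so the distance
    of the terms is controlled by their excess over \<open>m\<close>.\<close>
  have parallelogram: "(norm (x n - x k))\<^sup>2 \<le> 2 * (\<delta> n + \<delta> k)" for n k
  proof -
    have mid: "(1/2) *\<^sub>R (x n + x k) \<in> M"
      using xM \<open>subspace M\<close> by (intro subspace_scale subspace_add)
    have "2 * m \<le> 2 * J ((1/2) *\<^sub>R (x n + x k))" using m_le[OF mid] by simp
    also have "\<dots> = J (x n) + J (x k) - (norm (x n - x k))\<^sup>2 / 2"
    proof -
      have "L ((1/2) *\<^sub>R (x n + x k)) = (L (x n) + L (x k)) / 2"
        using xM \<open>subspace M\<close> by (simp add: scale add subspace_add del: scaleR_add_right)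
      then show ?thesis
        by (simp add: J_def power2_norm_eq_inner inner_add inner_diff inner_commute
            field_simps del: scaleR_add_right)
    qed
    finally show ?thesis using xJ[of n] xJ[of k] by simp
  qed
  have "Cauchy x"
  proof (rule metric_CauchyI)
    fix e :: real assume "e > 0"
    obtain N where N: "\<delta> N < e\<^sup>2 / 4"
      using reals_Archimedean[of "e\<^sup>2 / 4"] \<open>e > 0\<close> by (auto simp: \<delta>_def)
    have "dist (x n) (x k) < e" if "n \<ge> N" "k \<ge> N" for n k
    proof -
      have "\<delta> n \<le> \<delta> N" "\<delta> k \<le> \<delta> N"
        using that by (auto simp: \<delta>_def intro!: le_imp_inverse_le)
      then have "2 * (\<delta> n + \<delta> k) \<le> 4 * \<delta> N" by simp
      also have "\<dots> < e\<^sup>2" using N by simp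
      finally have "(norm (x n - x k))\<^sup>2 < e\<^sup>2"
        using parallelogram[of n k] by simp
      then show ?thesis
        using \<open>e > 0\<close> by (simp add: dist_norm power_less_imp_less_base)
    qed
    then show "\<exists>N. \<forall>n\<ge>N. \<forall>k\<ge>N. dist (x n) (x k) < e" by blast
  qed
  then obtain l where lim: "x \<longlonglongrightarrow> l" using Cauchy_convergent convergent_def by blast
  have "l \<in> M" using \<open>closed M\<close> xM lim closed_sequentially by blast
  have L_lim: "(\<lambda>n. L (x n)) \<longlonglongrightarrow> L l"
  proof (rule Lim_transform2[OF tendsto_const])
    show "(\<lambda>n. L l - L (x n)) \<longlonglongrightarrow> 0"
    proof (rule Lim_null_comparison)
      have "norm (L l - L (x n)) \<le> C * norm (l - x n)" for n
      proof -
        have "L (l - x n) = L l - L (x n)"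
          using add[of l "- x n"] scale[of "x n" "-1"] \<open>l \<in> M\<close> xM \<open>subspace M\<close>
          by (simp add: subspace_neg)
        then show ?thesis
          using bound[of "l - x n"] \<open>l \<in> M\<close> xM \<open>subspace M\<close> by (simp add: subspace_diff)
      qed
      then show "\<forall>\<^sub>F n in sequentially. norm (L l - L (x n)) \<le> C * norm (l - x n)" by simp
      have "(\<lambda>n. C * norm (l - x n)) \<longlonglongrightarrow> C * norm (l - l)"
        by (intro tendsto_intros lim)
      then show "(\<lambda>n. C * norm (l - x n)) \<longlonglongrightarrow> 0" by simp
    qed
  qed
  have "(\<lambda>n. J (x n)) \<longlonglongrightarrow> J l"
    unfolding J_def by (intro tendsto_intros lim L_lim)
  moreover have "(\<lambda>n. m + \<delta> n) \<longlonglongrightarrow> m + 0"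
    unfolding \<delta>_def by (intro tendsto_intros LIMSEQ_inverse_real_of_nat)
  ultimately have "J l \<le> m"
    using xJ by (intro LIMSEQ_le[where X = "\<lambda>n. J (x n)"]) (auto intro: less_imp_le)
  have "L y = l \<bullet> y" if "y \<in> M" for y
  proof -
    have "0 \<le> s\<^sup>2 * (y \<bullet> y) + 2 * s * (l \<bullet> y - L y)" for s
    proof -
      have sy: "s *\<^sub>R y \<in> M" using that \<open>subspace M\<close> by (rule subspace_scale[rotated])
      have "J l \<le> J (l + s *\<^sub>R y)"
        using m_le[of "l + s *\<^sub>R y"] \<open>J l \<le> m\<close> sy \<open>l \<in> M\<close> \<open>subspace M\<close>
        by (simp add: subspace_add)
      then show ?thesis
        using sy that \<open>l \<in> M\<close>
        by (simp add: J_def add scale algebra_simps power2_eq_square inner_commute)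
    qed
    from quadratic_nonneg_linear_coeff_zero[OF this] show ?thesis by simp
  qed
  with \<open>l \<in> M\<close> show thesis by (rule that)
qed

text \<open>A diagonal extraction makes the inner products with each \<open>x k\<close> converge.
  The vectors \<open>v\<close> for which \<open>y n \<bullet> v\<close> converges form a closed
  subspace \<open>D\<close> containing the sequence; the limit functional on \<open>D\<close> is
  represented by some \<open>l\<close>, and vectors outside \<open>D\<close> are handled by
  projecting them onto \<open>D\<close>.\<close>

lemma bounded_weakly_convergent_subsequence:
  fixes x :: "nat \<Rightarrow> 'a::{real_inner,complete_space}"
  assumes bound: "\<And>n. norm (x n) \<le> R"
  obtains r l where "strict_mono r" "weakly_converges (x \<circ> r) l"
proof -
  have R: "0 \<le> R" using bound[of 0] norm_ge_zero order_trans by blast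
  have "norm (x n \<bullet> x k) \<le> R * R" for n k
  proof -
    have "norm (x n \<bullet> x k) \<le> norm (x n) * norm (x k)"
      using Cauchy_Schwarz_ineq2 by simp
    also have "\<dots> \<le> R * R" using bound R by (intro mult_mono) auto
    finally show ?thesis .
  qed
  then obtain r where r: "strict_mono r" "\<And>k. \<exists>l. (\<lambda>n. x (r n) \<bullet> x k) \<longlonglongrightarrow> l"
    using function_convergent_subsequence[of "UNIV :: nat set" "\<lambda>n k. x n \<bullet> x k" "R * R"]
    by (metis UNIV_I countableI_type)
  define y where "y = x \<circ> r"
  have ybound: "norm (y n) \<le> R" for n using bound by (simp add: y_def)
  define D where "D = {v. convergent (\<lambda>n. y n \<bullet> v)}"
  have yD: "y n \<in> D" for n using r(2) by (simp add: D_def y_def convergent_def o_def)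
  have "subspace D"
    by (auto simp: subspace_def D_def inner_right_distrib convergent_const
        intro: convergent_add convergent_mult)
  have "closed D"
    unfolding closed_sequential_limits
  proof clarify
    fix d v assume d: "\<forall>k. d k \<in> D" "d \<longlonglongrightarrow> v"
    have "Cauchy (\<lambda>n. y n \<bullet> v)"
    proof (rule metric_CauchyI)
      fix e :: real assume "e > 0"
      \<comment> \<open>\<open>R + 1\<close> instead of \<open>R\<close> avoids a division by zero
        when \<open>R = 0\<close>.\<close>
      define e' where "e' = e / (3 * (R + 1))"
      have "e' > 0" using \<open>e > 0\<close> R by (simp add: e'_def)
      then obtain k where "norm (d k - v) < e'"
        using d(2) by (metis LIMSEQ_iff order_refl)
      have near: "\<bar>y n \<bullet> d k - y n \<bullet> v\<bar> < e / 3" for n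
      proof -
        have "\<bar>y n \<bullet> d k - y n \<bullet> v\<bar> \<le> norm (y n) * norm (d k - v)"
          using Cauchy_Schwarz_ineq2[of "y n" "d k - v"] by (simp add: inner_diff_right)
        also have "\<dots> \<le> R * e'"
          using ybound \<open>norm (d k - v) < e'\<close> R by (intro mult_mono) auto
        also have "\<dots> < (R + 1) * e'" using \<open>e' > 0\<close> by simp
        also have "\<dots> = e / 3" using R by (simp add: e'_def field_simps)
        finally show ?thesis .
      qed
      have "Cauchy (\<lambda>n. y n \<bullet> d k)"
        using d(1) by (auto simp: D_def intro: convergent_Cauchy)
      then obtain N where N: "\<And>n m. n \<ge> N \<Longrightarrow> m \<ge> N \<Longrightarrow> \<bar>y n \<bullet> d k - y m \<bullet> d k\<bar> < e / 3"
        using metric_CauchyD[of "\<lambda>n. y n \<bullet> d k" "e / 3"] \<open>e > 0\<close> by (auto simp: dist_real_def)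
      have "dist (y n \<bullet> v) (y m \<bullet> v) < e" if "n \<ge> N" "m \<ge> N" for n m
        using N[OF that] near[of n] near[of m] unfolding dist_real_def by linarith
      then show "\<exists>N. \<forall>n\<ge>N. \<forall>m\<ge>N. dist (y n \<bullet> v) (y m \<bullet> v) < e" by blast
    qed
    then show "v \<in> D" by (simp add: D_def Cauchy_convergent_iff)
  qed
  define L where "L v = lim (\<lambda>n. y n \<bullet> v)" for v
  have L: "(\<lambda>n. y n \<bullet> v) \<longlonglongrightarrow> L v" if "v \<in> D" for v
    using that by (simp add: D_def L_def convergent_LIMSEQ_iff)
  have "L (v + w) = L v + L w" if "v \<in> D" "w \<in> D" for v w
  proof (rule LIMSEQ_unique)
    show "(\<lambda>n. y n \<bullet> (v + w)) \<longlonglongrightarrow> L (v + w)"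
      using that \<open>subspace D\<close> by (intro L subspace_add)
    show "(\<lambda>n. y n \<bullet> (v + w)) \<longlonglongrightarrow> L v + L w"
      unfolding inner_right_distrib by (intro tendsto_add L that)
  qed
  moreover have "L (s *\<^sub>R v) = s * L v" if "v \<in> D" for s v
  proof (rule LIMSEQ_unique)
    show "(\<lambda>n. y n \<bullet> (s *\<^sub>R v)) \<longlonglongrightarrow> L (s *\<^sub>R v)"
      using that \<open>subspace D\<close> by (intro L subspace_scale)
    show "(\<lambda>n. y n \<bullet> (s *\<^sub>R v)) \<longlonglongrightarrow> s * L v"
      unfolding inner_scaleR_right by (intro tendsto_mult_left L that)
  qed
  moreover have "\<bar>L v\<bar> \<le> R * norm v" if "v \<in> D" for v
  proof (rule LIMSEQ_le_const2)
    show "(\<lambda>n. \<bar>y n \<bullet> v\<bar>) \<longlonglongrightarrow> \<bar>L v\<bar>" by (intro tendsto_rabs L that)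
    have "\<bar>y n \<bullet> v\<bar> \<le> R * norm v" for n
      using Cauchy_Schwarz_ineq2[of "y n" v] mult_right_mono[OF ybound[of n], of "norm v"]
      by simp
    then show "\<exists>N. \<forall>n\<ge>N. \<bar>y n \<bullet> v\<bar> \<le> R * norm v" by blast
  qed
  ultimately obtain l where l: "l \<in> D" "\<And>v. v \<in> D \<Longrightarrow> L v = l \<bullet> v"
    using riesz_on_closed_subspace[OF \<open>closed D\<close> \<open>subspace D\<close>, of L R] by metis
  have "(\<lambda>n. y n \<bullet> v) \<longlonglongrightarrow> l \<bullet> v" for v
  proof -
    have "\<bar>d \<bullet> v\<bar> \<le> norm v * norm d" for d
      using Cauchy_Schwarz_ineq2[of d v] by (simp add: mult.commute)
    \<comment> \<open>\<open>p\<close> is the orthogonal projection of \<open>v\<close> onto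
      \<open>D\<close>, found by representing the functional \<open>d \<bullet> v\<close> on
      \<open>D\<close>. The \<open>y n\<close> and \<open>l\<close> lie in \<open>D\<close> and
      cannot distinguish \<open>v\<close> from \<open>p\<close>.\<close>
    then obtain p where p: "p \<in> D" "\<And>d. d \<in> D \<Longrightarrow> d \<bullet> v = p \<bullet> d"
      using riesz_on_closed_subspace[OF \<open>closed D\<close> \<open>subspace D\<close>, of "\<lambda>d. d \<bullet> v" "norm v"]
      by (metis inner_add_left inner_scaleR_left)
    have "(\<lambda>n. y n \<bullet> p) \<longlonglongrightarrow> l \<bullet> p" using L[OF p(1)] l(2)[OF p(1)] by simp
    then show ?thesis using p(2)[OF yD] p(2)[OF l(1)] by (simp add: inner_commute)
  qed
  with r(1) show thesis by (intro that) (auto simp: weakly_converges_def y_def)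
qed

lemma weakly_seq_continuousD:
  "\<lbrakk>weakly_seq_continuous f; weakly_converges x u; weakly_converges y v\<rbrakk>
    \<Longrightarrow> (\<lambda>n. f (x n) (y n)) \<longlonglongrightarrow> f u v"
  by (auto simp: weakly_seq_continuous_def)

lemma weakly_converges_const: "weakly_converges (\<lambda>_. u) u"
  by (simp add: weakly_converges_def)

lemma tendsto_imp_weakly_converges: "x \<longlonglongrightarrow> u \<Longrightarrow> weakly_converges x u"
  by (auto simp: weakly_converges_def intro: tendsto_intros)

text \<open>Needed for \<open>a u l\<close> as a function of \<open>u\<close>, because
  \<open>a\<close> is assumed continuous only in norm.\<close>

lemma bounded_functional_weakly_continuous:
  fixes L :: "'a::{real_inner,complete_space} \<Rightarrow> real"
  assumes "linear L" "\<And>x. \<bar>L x\<bar> \<le> C * norm x" "weakly_converges x u"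
  shows "(\<lambda>n. L (x n)) \<longlonglongrightarrow> L u"
proof -
  obtain l where "\<And>x. L x = l \<bullet> x"
    using riesz_on_closed_subspace[of UNIV L C] assms(2)
    by (auto simp: linear_add[OF assms(1)] linear_scale[OF assms(1)])
  then show ?thesis
    using assms(3) by (simp add: weakly_converges_def inner_commute)
qed

section \<open>Bilinear forms\<close>

text \<open>If no bound exists, pairs violating the bounds \<open>(n + 1)\<^sup>2\<close> can be
  rescaled to norm \<open>1 / (n + 1)\<close> each; they tend to 0 while \<open>h\<close> stays at
  least 1 in absolute value.\<close>

lemma bilinear_bounded_if_continuous_at_0:
  fixes h :: "'a::real_inner \<Rightarrow> 'a \<Rightarrow> real"
  assumes h: "bilinear h"
    and cont: "\<And>x y. x \<longlonglongrightarrow> 0 \<Longrightarrow> y \<longlonglongrightarrow> 0 \<Longrightarrow> (\<lambda>n. h (x n) (y n)) \<longlonglongrightarrow> 0"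
  obtains M where "M > 0" "\<And>u v. \<bar>h u v\<bar> \<le> M * norm u * norm v"
proof (rule ccontr)
  assume *: "\<not> thesis"
  have "\<exists>u v. \<bar>h u v\<bar> > (real (Suc n))\<^sup>2 * norm u * norm v" for n
    using * that[of "(real (Suc n))\<^sup>2"] by (force simp: not_le)
  then obtain u v where uv: "\<bar>h (u n) (v n)\<bar> > (real (Suc n))\<^sup>2 * norm (u n) * norm (v n)" for n
    by metis
  have nz: "norm (u n) > 0" "norm (v n) > 0" for n
    using uv[of n] bilinear_lzero[OF h] bilinear_rzero[OF h] by auto
  define x where "x n = inverse (real (Suc n) * norm (u n)) *\<^sub>R u n" for n
  define y where "y n = inverse (real (Suc n) * norm (v n)) *\<^sub>R v n" for n
  have "norm (x n) = inverse (real (Suc n))" "norm (y n) = inverse (real (Suc n))" for n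
    using nz[of n] by (auto simp: x_def y_def)
  then have "x \<longlonglongrightarrow> 0" "y \<longlonglongrightarrow> 0"
    using LIMSEQ_inverse_real_of_nat tendsto_norm_zero_iff[of x sequentially]
      tendsto_norm_zero_iff[of y sequentially] by simp_all
  then have "(\<lambda>n. \<bar>h (x n) (y n)\<bar>) \<longlonglongrightarrow> \<bar>0\<bar>" by (intro tendsto_rabs cont)
  moreover have "1 \<le> \<bar>h (x n) (y n)\<bar>" for n
  proof -
    have "\<bar>h (x n) (y n)\<bar> = \<bar>h (u n) (v n)\<bar> / ((real (Suc n))\<^sup>2 * norm (u n) * norm (v n))"
      using nz[of n]
      by (simp add: x_def y_def bilinear_lmul[OF h] bilinear_rmul[OF h] abs_mult
          power2_eq_square field_simps del: of_nat_Suc)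
    also have "\<dots> \<ge> 1" using uv[of n] nz[of n] by (simp add: le_divide_eq)
    finally show ?thesis .
  qed
  ultimately have "1 \<le> \<bar>0::real\<bar>" by (intro LIMSEQ_le_const) auto
  then show False by simp
qed

lemma continuous_bilinear_bounded:
  fixes h :: "'a::real_inner \<Rightarrow> 'a \<Rightarrow> real"
  assumes "bilinear h" "continuous_on UNIV (\<lambda>(u, v). h u v)"
  obtains M where "M > 0" "\<And>u v. \<bar>h u v\<bar> \<le> M * norm u * norm v"
proof (rule bilinear_bounded_if_continuous_at_0[OF assms(1)])
  fix x y :: "nat \<Rightarrow> 'a" assume "x \<longlonglongrightarrow> 0" "y \<longlonglongrightarrow> 0"
  then have "(\<lambda>n. (\<lambda>(u, v). h u v) (x n, y n)) \<longlonglongrightarrow> (\<lambda>(u, v). h u v) (0, 0)"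
    by (intro continuous_on_tendsto_compose[OF assms(2)] tendsto_Pair) auto
  then show "(\<lambda>n. h (x n) (y n)) \<longlonglongrightarrow> 0" by (simp add: bilinear_lzero[OF assms(1)])
qed (rule that)

lemma weakly_seq_continuous_bilinear_bounded:
  fixes h :: "'a::real_inner \<Rightarrow> 'a \<Rightarrow> real"
  assumes "bilinear h" "weakly_seq_continuous h"
  obtains M where "M > 0" "\<And>u v. \<bar>h u v\<bar> \<le> M * norm u * norm v"
proof (rule bilinear_bounded_if_continuous_at_0[OF assms(1)])
  fix x y :: "nat \<Rightarrow> 'a" assume "x \<longlonglongrightarrow> 0" "y \<longlonglongrightarrow> 0"
  then show "(\<lambda>n. h (x n) (y n)) \<longlonglongrightarrow> 0"
    using weakly_seq_continuousD[OF assms(2), of x 0 y 0]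
    by (simp add: tendsto_imp_weakly_converges bilinear_lzero[OF assms(1)])
qed (rule that)

text \<open>A null vector minimizes the nonnegative quadratic form on \<open>W\<close>, so its first
  variation vanishes. This later turns minimality of a Rayleigh quotient into an eigenvalue
  equation.\<close>

lemma nonneg_form_null_vector:
  assumes h: "symmetric_bilinear h" and "subspace W"
    and nonneg: "\<And>v. v \<in> W \<Longrightarrow> 0 \<le> h v v" and "w \<in> W" "h w w = 0" "v \<in> W"
  shows "h w v = 0"
proof (rule quadratic_nonneg_linear_coeff_zero)
  fix s :: real
  have b: "bilinear h" and sym: "h v w = h w v"
    using h by (auto simp: symmetric_bilinear_def)
  have "0 \<le> h (w + s *\<^sub>R v) (w + s *\<^sub>R v)"
    using assms by (intro nonneg subspace_add subspace_scale)
  also have "\<dots> = s\<^sup>2 * h v v + 2 * s * h w v"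
    using \<open>h w w = 0\<close> sym
    by (simp add: bilinear_ladd[OF b] bilinear_radd[OF b] bilinear_lmul[OF b]
        bilinear_rmul[OF b] power2_eq_square algebra_simps)
  finally show "0 \<le> s\<^sup>2 * h v v + 2 * s * h w v" .
qed

text \<open>The map \<open>h\<close> collects the values \<open>g u t\<close> as coefficients of a
  basis \<open>T'\<close> of \<open>span T\<close>. It sends \<open>span B\<close> into a space of
  smaller dimension, so it has a nonzero kernel vector there, and independence of \<open>T'\<close>
  makes all those values vanish.\<close>

lemma exists_orthogonal_to_span:
  fixes g :: "'a::real_vector \<Rightarrow> 'a \<Rightarrow> real"
  assumes g: "bilinear g" and "finite T" "finite B" "independent B" "card T < card B"
  obtains u where "u \<in> span B" "u \<noteq> 0" "\<And>x. x \<in> span T \<Longrightarrow> g u x = 0"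
proof -
  obtain T' where T': "T' \<subseteq> T" "independent T'" "T \<subseteq> span T'"
    using maximal_independent_subset by blast
  have "finite T'" "card T' \<le> card T"
    using T' \<open>finite T\<close> by (auto intro: card_mono finite_subset)
  define h where "h u = (\<Sum>t\<in>T'. g u t *\<^sub>R t)" for u
  have "linear h"
    by (auto intro!: linearI simp: h_def bilinear_ladd[OF g] bilinear_lmul[OF g]
        scaleR_add_left sum.distrib scaleR_sum_right)
  have "\<not> inj_on h (span B)"
  proof
    assume inj: "inj_on h (span B)"
    then have "independent (h ` B)"
      using \<open>linear h\<close> \<open>independent B\<close> linear_independent_injective_image by blast
    moreover have "h ` B \<subseteq> span T'" by (auto simp: h_def intro: span_sum span_scale span_base)
    ultimately have "card (h ` B) \<le> card T'"
      using independent_span_bound \<open>finite T'\<close> by blast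
    moreover have "card (h ` B) = card B"
      using inj by (meson card_image inj_on_subset span_superset)
    ultimately show False using \<open>card T' \<le> card T\<close> \<open>card T < card B\<close> by simp
  qed
  then obtain u where u: "u \<in> span B" "u \<noteq> 0" "h u = 0"
    using linear_injective_on_subspace_0[OF \<open>linear h\<close> subspace_span] by blast
  have "g u t = 0" if "t \<in> T'" for t
    using u(3) T'(2) \<open>finite T'\<close> that by (auto simp: h_def dest: independentD[where t = T' and u = "g u"])
  moreover have "linear (g u)" using g by (simp add: bilinear_def)
  ultimately have "g u x = 0" if "x \<in> span T'" for x
    using linear_eq_0_on_span that by blast
  moreover have "span T \<subseteq> span T'" using T' by (simp add: span_minimal)
  ultimately show thesis using that u by blast
qed

text \<open>Adding \<open>v\<close> to a basis of \<open>span B\<close> raises the dimension by one,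
  so some nonzero \<open>w\<close> in the larger span is orthogonal to \<open>span B\<close>.
  Nondegeneracy forces a nonzero \<open>v\<close>-coefficient in \<open>w\<close>, and dividing by
  it gives the projection.\<close>

lemma form_projection_onto_span:
  fixes g :: "'a::real_vector \<Rightarrow> 'a \<Rightarrow> real"
  assumes g: "bilinear g" and "finite B"
    and nondeg: "\<And>u. u \<in> span B \<Longrightarrow> u \<noteq> 0 \<Longrightarrow> g u u \<noteq> 0"
  obtains u where "u \<in> span B" "\<And>x. x \<in> span B \<Longrightarrow> g (v - u) x = 0"
proof (cases "v \<in> span B")
  case True
  then show thesis by (intro that[of v]) (auto simp: bilinear_lzero[OF g])
next
  case False
  obtain T where T: "T \<subseteq> B" "independent T" "B \<subseteq> span T"
    using maximal_independent_subset by blast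
  have "finite T" using T(1) \<open>finite B\<close> finite_subset by blast
  have span: "span T = span B"
    using T by (metis span_eq span_superset subset_trans)
  have "v \<notin> span T" using False span by simp
  then have "independent (insert v T)" "v \<notin> T" using T(2) by (simp_all add: independent_insertI) (auto intro: span_base)
  then obtain w where w: "w \<in> span (insert v T)" "w \<noteq> 0" "\<And>x. x \<in> span T \<Longrightarrow> g w x = 0"
    using exists_orthogonal_to_span[OF g \<open>finite T\<close>, of "insert v T"] \<open>finite T\<close> by auto
  then obtain k where k: "w - k *\<^sub>R v \<in> span T" by (auto simp: span_breakdown_eq)
  have "k \<noteq> 0" using k w nondeg[of w] span by auto
  define u where "u = v - (1 / k) *\<^sub>R w"
  have "- (1 / k) *\<^sub>R (w - k *\<^sub>R v) \<in> span T" by (rule span_scale[OF k])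
  then have "u \<in> span T"
    using \<open>k \<noteq> 0\<close> by (simp add: u_def scaleR_diff_right)
  moreover have "g (v - u) x = 0" if "x \<in> span T" for x
    using w(3)[OF that] by (simp add: u_def bilinear_lmul[OF g])
  ultimately show thesis using that span by simp
qed

text \<open>Coordinates in an orthogonal basis are inner products, so weak convergence inside a
  finite-dimensional subspace is strong.\<close>

lemma coercive_on_span_of_finite:
  fixes f :: "'a::{real_inner,complete_space} \<Rightarrow> 'a \<Rightarrow> real"
  assumes f: "bilinear f" "weakly_seq_continuous f" and "finite B"
    and pos: "\<And>u. u \<in> span B \<Longrightarrow> u \<noteq> 0 \<Longrightarrow> 0 < f u u"
  shows "coercive_on (span B) f"
proof (rule ccontr)
  assume not: "\<not> coercive_on (span B) f"
  have "\<exists>u\<in>span B. f u u < inverse (Suc n) * (norm u)\<^sup>2" for n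
    using not by (force simp: coercive_on_def not_le)
  then obtain x where x: "x n \<in> span B" "f (x n) (x n) < inverse (Suc n) * (norm (x n))\<^sup>2" for n
    by metis
  have xnz: "x n \<noteq> 0" for n using x(2)[of n] bilinear_lzero[OF f(1)] by auto
  define y where "y n = (1 / norm (x n)) *\<^sub>R x n" for n
  have y: "y n \<in> span B" "norm (y n) = 1" for n
    using x xnz by (auto simp: y_def span_scale)
  have fy: "f (y n) (y n) \<le> inverse (Suc n)" for n
  proof -
    have "f (y n) (y n) = f (x n) (x n) / (norm (x n))\<^sup>2"
      by (simp add: y_def bilinear_lmul[OF f(1)] bilinear_rmul[OF f(1)] power2_eq_square)
    also have "\<dots> \<le> inverse (Suc n)"
      using x(2)[of n] xnz[of n] by (simp add: divide_le_eq del: of_nat_Suc)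
    finally show ?thesis .
  qed
  obtain C where C: "finite C" "span C = span B" "pairwise orthogonal C"
    using basis_orthogonal[OF \<open>finite B\<close>] by blast
  \<comment> \<open>The orthogonal set \<open>C\<close> might contain 0; its coefficient is then 0
    because division by zero yields 0, and the expansion remains valid.\<close>
  define P where "P u = (\<Sum>c\<in>C. ((u \<bullet> c) / (c \<bullet> c)) *\<^sub>R c)" for u
  have P_mem: "P u \<in> span C" for u
    by (auto simp: P_def intro: span_sum span_scale span_base)
  have P_id: "P u = u" if "u \<in> span C" for u
  proof -
    have "orthogonal (u - P u) c" if "c \<in> C" for c
    proof -
      have "P u \<bullet> c = (\<Sum>d\<in>C. if d = c then u \<bullet> c else 0)"
        unfolding P_def inner_sum_left
        using C(3) that by (intro sum.cong) (auto simp: pairwise_def orthogonal_def)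
      then show ?thesis
        using C(1) that by (simp add: orthogonal_def inner_diff_left)
    qed
    then have "orthogonal (u - P u) z" if "z \<in> span C" for z
      using that by (rule orthogonal_to_span[rotated])
    moreover have "u - P u \<in> span C" using that P_mem by (simp add: span_diff)
    ultimately have "u - P u = 0" by (metis orthogonal_self)
    then show ?thesis by simp
  qed
  obtain r l where r: "strict_mono r" "weakly_converges (y \<circ> r) l"
    using bounded_weakly_convergent_subsequence[of y 1] y(2) by auto
  have "(\<lambda>n. P (y (r n))) \<longlonglongrightarrow> P l"
    unfolding P_def divide_inverse using r(2)
    by (intro tendsto_sum tendsto_scaleR tendsto_mult_right tendsto_const)
      (simp add: weakly_converges_def)
  \<comment> \<open>\<open>P\<close> fixes the sequence, so its weak limit is attained in norm; in
    particular the limit \<open>P l\<close> is again a unit vector and positivity applies to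
    it.\<close>
  then have lim: "(\<lambda>n. y (r n)) \<longlonglongrightarrow> P l" using P_id y(1) C(2) by simp
  then have "(\<lambda>n. norm (y (r n))) \<longlonglongrightarrow> norm (P l)" by (rule tendsto_norm)
  then have "norm (P l) = 1" using y(2) by (simp add: LIMSEQ_const_iff)
  then have "P l \<noteq> 0" by auto
  then have "0 < f (P l) (P l)" using pos[of "P l"] P_mem C(2) by auto
  moreover have "(\<lambda>n. f (y (r n)) (y (r n))) \<longlonglongrightarrow> f (P l) (P l)"
    by (intro weakly_seq_continuousD[OF f(2)] tendsto_imp_weakly_converges lim)
  moreover have "(\<lambda>n. inverse (real (Suc (r n)))) \<longlonglongrightarrow> 0"
    using LIMSEQ_subseq_LIMSEQ[OF LIMSEQ_inverse_real_of_nat r(1)] by (simp add: o_def)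
  ultimately show False
    using fy LIMSEQ_le[of "\<lambda>n. f (y (r n)) (y (r n))" _ "\<lambda>n. inverse (real (Suc (r n)))" 0]
    by force
qed

section \<open>Extended dimensions\<close>

text \<open>If all values were below \<open>j\<close>, the supremum would be at most
  \<open>j - 1\<close>. Nonemptiness of \<open>S\<close> excludes \<open>j = 0\<close> in this
  argument.\<close>

lemma enat_le_SUP_attained:
  assumes "S \<noteq> {}" "enat j \<le> (SUP x\<in>S. enat (g x))"
  obtains x where "x \<in> S" "j \<le> g x"
proof (rule ccontr)
  assume "\<not> thesis"
  with that have *: "g x < j" if "x \<in> S" for x using \<open>x \<in> S\<close> by (meson not_le)
  then have "j > 0" using \<open>S \<noteq> {}\<close> by fastforce
  have "(SUP x\<in>S. enat (g x)) \<le> enat (j - 1)"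
    using * by (intro SUP_least) fastforce
  then have "enat j \<le> enat (j - 1)" using assms(2) by (rule order_trans[rotated])
  then show False using \<open>j > 0\<close> by simp
qed

lemma card_le_edim: "\<lbrakk>finite B; B \<subseteq> V; independent B\<rbrakk> \<Longrightarrow> enat (card B) \<le> edim V"
  unfolding edim_def by (rule SUP_upper) auto

lemma edim_mono: "U \<subseteq> V \<Longrightarrow> edim U \<le> edim V"
  unfolding edim_def by (rule SUP_subset_mono) auto

lemma le_edimE:
  assumes "enat j \<le> edim V"
  obtains B where "finite B" "B \<subseteq> V" "independent B" "card B = j"
proof -
  have "{} \<in> {B. finite B \<and> B \<subseteq> V \<and> independent B}"
    by (auto simp: independent_empty)
  then obtain B where B: "finite B" "B \<subseteq> V" "independent B" "j \<le> card B"
    using enat_le_SUP_attained[OF _ assms[unfolded edim_def]] by (metis (mono_tags, lifting) empty_iff mem_Collect_eq)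
  obtain C where "C \<subseteq> B" "card C = j" using obtain_subset_with_card_n[OF B(4)] by metis
  moreover from this have "finite C" "C \<subseteq> V" "independent C"
    using B independent_mono by (auto intro: finite_subset)
  ultimately show thesis using that by blast
qed

lemma edim_span: "\<lbrakk>finite B; independent B\<rbrakk> \<Longrightarrow> edim (span B) = enat (card B)"
proof (rule antisym)
  assume B: "finite B" "independent B"
  then show "edim (span B) \<le> enat (card B)"
    unfolding edim_def using independent_span_bound by (intro SUP_least) auto
  show "enat (card B) \<le> edim (span B)" using B by (intro card_le_edim span_superset)
qed

lemma finite_edim_basis:
  assumes "subspace V" "edim V < \<infinity>"
  obtains B where "finite B" "independent B" "span B = V" "edim V = enat (card B)"
proof -
  obtain n where n: "edim V = enat n" using assms(2) by auto
  obtain B where B: "finite B" "B \<subseteq> V" "independent B" "card B = n"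
    using le_edimE[of n V] n by auto
  have "V \<subseteq> span B"
  proof
    fix v assume "v \<in> V"
    show "v \<in> span B"
    proof (rule ccontr)
      assume v: "v \<notin> span B"
      then have "v \<notin> B" by (auto intro: span_base)
      have "enat (card (insert v B)) \<le> edim V"
        using B v \<open>v \<in> V\<close> by (intro card_le_edim) (auto simp: independent_insertI)
      then show False using B \<open>v \<notin> B\<close> n by simp
    qed
  qed
  moreover have "span B \<subseteq> V" using B(2) assms(1) by (rule span_minimal)
  ultimately show thesis using that B n by auto
qed

lemma independent_Un_if_spans_disjoint:
  assumes "finite B" "independent B" "independent C" "span B \<inter> span C = {0}"
  shows "independent (B \<union> C)"
  using assms
proof (induction B rule: finite_induct)
  case (insert b B)
  have b: "b \<notin> span B" "independent B"
    using insert.prems(1) insert.hyps(2) by (auto simp: independent_insert)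
  have "span B \<subseteq> span (insert b B)" by (rule span_mono) auto
  then have disj: "span B \<inter> span C = {0}"
    using insert.prems(3) by (auto simp: span_zero)
  have "b \<notin> span (B \<union> C)"
  proof
    assume "b \<in> span (B \<union> C)"
    then obtain x y where xy: "b = x + y" "x \<in> span B" "y \<in> span C" by (auto simp: span_Un)
    have "y = b - x" using xy by simp
    also have "\<dots> \<in> span (insert b B)"
      using xy \<open>span B \<subseteq> span (insert b B)\<close> by (intro span_diff) (auto intro: span_base)
    finally have "y = 0" using xy insert.prems(3) by auto
    then show False using xy b by simp
  qed
  then show ?case
    using insert.IH[OF b(2) insert.prems(2) disj] by (simp add: independent_insertI)
qed simp

lemma edim_span_Un:
  assumes "subspace U" "subspace V" "edim U < \<infinity>" "edim V < \<infinity>" "U \<inter> V = {0}"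
  shows "edim (span (U \<union> V)) = edim U + edim V"
proof -
  obtain B where B: "finite B" "independent B" "span B = U" "edim U = enat (card B)"
    using finite_edim_basis assms by blast
  obtain C where C: "finite C" "independent C" "span C = V" "edim V = enat (card C)"
    using finite_edim_basis assms by blast
  have "independent (B \<union> C)"
    using B C assms by (intro independent_Un_if_spans_disjoint) auto
  moreover have "B \<inter> C = {}"
  proof -
    have "B \<inter> C \<subseteq> {0}" using B(3) C(3) assms(5) span_superset by blast
    then show ?thesis using B(2) dependent_zero by blast
  qed
  moreover have "span (U \<union> V) = span (B \<union> C)"
    unfolding B(3)[symmetric] C(3)[symmetric] by (simp only: span_Un span_span)
  ultimately show ?thesis using B C by (simp add: edim_span card_Un_disjoint)
qed

lemma subspace_form_ker: "bilinear h \<Longrightarrow> subspace (form_ker h)"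
  by (auto simp: subspace_def form_ker_def bilinear_lzero bilinear_ladd bilinear_lmul)

lemma subspace_form_orthogonal:
  "bilinear h \<Longrightarrow> subspace {u. \<forall>w\<in>Z. h u w = 0}"
  by (auto simp: subspace_def bilinear_lzero bilinear_ladd bilinear_lmul)

section \<open>The eigenvalue problem for a fixed pencil parameter\<close>

text \<open>The fixed case provides these assumptions for every \<open>t\<close>, the moving case
  for large \<open>t\<close>. Negativity of \<open>f\<close> on the kernel of \<open>a\<close>
  allows the kernel to be split off by an \<open>f\<close>-orthogonal projection; coercivity is
  asked only on the \<open>f\<close>-orthogonal complement, where all eigenvectors with nonzero
  eigenvalue lie.\<close>

locale coercive_pencil =
  fixes a f :: "'a::{real_inner,complete_space} \<Rightarrow> 'a \<Rightarrow> real"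
  assumes a_form: "symmetric_bilinear a" and f_form: "symmetric_bilinear f"
    and a_cont: "continuous_on UNIV (\<lambda>(u, v). a u v)"
    and f_cont: "weakly_seq_continuous f"
    and ker_finite: "edim (form_ker a) < \<infinity>"
    and f_neg_ker: "\<And>u. u \<in> form_ker a \<Longrightarrow> u \<noteq> 0 \<Longrightarrow> f u u < 0"
    and coercive: "coercive_on {u. \<forall>w\<in>form_ker a. f u w = 0} a"
begin

text \<open>For \<open>f = pencil b c t\<close> this is \<open>moving_space a b c t\<close>.\<close>

definition S where "S = {u. \<forall>w\<in>form_ker a. f u w = 0}"

definition eig_span where "eig_span I = span (\<Union>\<mu>\<in>I. eigenspace a f \<mu>)"

lemma bil: "bilinear a" "bilinear f" and sym: "a u v = a v u" "f u v = f v u"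
  using a_form f_form by (auto simp: symmetric_bilinear_def)

lemmas bil_simps =
  bilinear_ladd[OF bil(1)] bilinear_radd[OF bil(1)] bilinear_ladd[OF bil(2)] bilinear_radd[OF bil(2)]
  bilinear_lmul[OF bil(1)] bilinear_rmul[OF bil(1)] bilinear_lmul[OF bil(2)] bilinear_rmul[OF bil(2)]
  bilinear_lsub[OF bil(1)] bilinear_rsub[OF bil(1)] bilinear_lsub[OF bil(2)] bilinear_rsub[OF bil(2)]
  bilinear_lzero[OF bil(1)] bilinear_rzero[OF bil(1)] bilinear_lzero[OF bil(2)] bilinear_rzero[OF bil(2)]

lemma linear_forms: "linear (a u)" "linear (f u)"
  using bil by (auto simp: bilinear_def)

lemma subspace_S: "subspace S"
  unfolding S_def using bil by (intro subspace_form_orthogonal)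

lemma obtain_coercivity:
  obtains \<gamma> where "\<gamma> > 0" "\<And>u. u \<in> S \<Longrightarrow> \<gamma> * (norm u)\<^sup>2 \<le> a u u"
  using coercive by (auto simp: coercive_on_def S_def)

lemma a_nonneg: "u \<in> S \<Longrightarrow> 0 \<le> a u u"
proof -
  assume "u \<in> S"
  obtain \<gamma> where "\<gamma> > 0" "\<gamma> * (norm u)\<^sup>2 \<le> a u u"
    using obtain_coercivity \<open>u \<in> S\<close> by metis
  moreover from this(1) have "0 \<le> \<gamma> * (norm u)\<^sup>2" by simp
  ultimately show ?thesis by linarith
qed

lemma a_pos: "u \<in> S \<Longrightarrow> u \<noteq> 0 \<Longrightarrow> 0 < a u u"
proof -
  assume "u \<in> S" "u \<noteq> 0"
  obtain \<gamma> where "\<gamma> > 0" "\<gamma> * (norm u)\<^sup>2 \<le> a u u"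
    using obtain_coercivity \<open>u \<in> S\<close> by metis
  moreover from this(1) \<open>u \<noteq> 0\<close> have "0 < \<gamma> * (norm u)\<^sup>2" by simp
  ultimately show ?thesis by linarith
qed

section \<open>Eigenspaces and their spans\<close>

lemma subspace_eigenspace: "subspace (eigenspace a f \<mu>)"
  by (auto simp: subspace_def eigenspace_def bil_simps algebra_simps)

lemma eigenspace_subset_S: "\<mu> \<noteq> 0 \<Longrightarrow> eigenspace a f \<mu> \<subseteq> S"
proof
  fix u assume \<mu>: "\<mu> \<noteq> 0" and u: "u \<in> eigenspace a f \<mu>"
  have "f u w = 0" if "w \<in> form_ker a" for w
  proof -
    have "a u w = 0" using that sym(1)[of u w] by (simp add: form_ker_def)
    moreover have "a u w = \<mu> * f u w" using u by (simp add: eigenspace_def)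
    ultimately show ?thesis using \<mu> by simp
  qed
  then show "u \<in> S" by (simp add: S_def)
qed

lemma eig_span_subset_S: "0 \<notin> I \<Longrightarrow> eig_span I \<subseteq> S"
proof -
  assume "0 \<notin> I"
  then have "eigenspace a f \<mu> \<subseteq> S" if "\<mu> \<in> I" for \<mu>
    using that by (intro eigenspace_subset_S) auto
  then show ?thesis unfolding eig_span_def by (intro span_minimal subspace_S) blast
qed

lemma subspace_eig_span: "subspace (eig_span I)"
  by (simp add: eig_span_def)

lemma eig_span_mono: "I \<subseteq> J \<Longrightarrow> eig_span I \<subseteq> eig_span J"
  unfolding eig_span_def by (intro span_mono) auto

lemma eigenvectors_orthogonal:
  assumes "u \<in> eigenspace a f \<mu>" "v \<in> eigenspace a f \<nu>" "\<mu> \<noteq> \<nu>"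
  shows "a u v = 0" "f u v = 0"
proof -
  have "a u v = \<mu> * f u v" "a v u = \<nu> * f v u"
    using assms by (auto simp: eigenspace_def)
  then have "(\<mu> - \<nu>) * f u v = 0"
    using sym(1)[of u v] sym(2)[of u v] by (simp only: left_diff_distrib)
  then show "f u v = 0" using assms(3) by simp
  then show "a u v = 0" using \<open>a u v = \<mu> * f u v\<close> by simp
qed

lemma eigenvector_orthogonal_eig_span:
  assumes "u \<in> eigenspace a f \<mu>" "v \<in> eig_span I" "\<mu> \<notin> I"
  shows "a u v = 0" "f u v = 0"
proof -
  have orth: "a u w = 0" "f u w = 0" if "w \<in> (\<Union>\<nu>\<in>I. eigenspace a f \<nu>)" for w
    using that assms eigenvectors_orthogonal by blast+
  have v: "v \<in> span (\<Union>\<nu>\<in>I. eigenspace a f \<nu>)" using assms(2) by (simp add: eig_span_def)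
  show "a u v = 0" by (rule linear_eq_0_on_span[OF linear_forms(1) _ v]) (rule orth)
  show "f u v = 0" by (rule linear_eq_0_on_span[OF linear_forms(2) _ v]) (rule orth)
qed

text \<open>Each vector of the span uses finitely many eigenspaces. This reduces claims about an
  interval of eigenvalues to finite sets, where induction is available.\<close>

lemma eig_span_finite_cases:
  assumes "B \<subseteq> eig_span I" "finite B"
  obtains F where "finite F" "F \<subseteq> I" "B \<subseteq> eig_span F"
proof -
  have single: "\<exists>F. finite F \<and> F \<subseteq> I \<and> u \<in> eig_span F" if "u \<in> eig_span I" for u
    using that unfolding eig_span_def
  proof (induction rule: span_induct_alt)
    case base
    show ?case by (intro exI[of _ "{}"]) (auto simp: span_zero)
  next
    case (step k x y)
    then obtain \<mu> F where F: "\<mu> \<in> I" "x \<in> eigenspace a f \<mu>" "finite F" "F \<subseteq> I" "y \<in> eig_span F"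
      by (auto simp: eig_span_def)
    have "x \<in> eig_span (insert \<mu> F)" using F by (auto simp: eig_span_def intro: span_base)
    moreover have "y \<in> eig_span (insert \<mu> F)" using F eig_span_mono[of F "insert \<mu> F"] by auto
    ultimately have "k *\<^sub>R x + y \<in> eig_span (insert \<mu> F)"
      by (simp add: subspace_eig_span subspace_add subspace_scale)
    then show ?case using F by (intro exI[of _ "insert \<mu> F"]) (auto simp: eig_span_def)
  qed
  obtain F where F: "\<And>u. u \<in> B \<Longrightarrow> finite (F u) \<and> F u \<subseteq> I \<and> u \<in> eig_span (F u)"
    using single assms(1) by (metis subsetD)
  have "B \<subseteq> eig_span (\<Union>u\<in>B. F u)"
    using F eig_span_mono by (meson UN_upper subsetD subsetI)
  then show thesis using F \<open>finite B\<close> by (intro that[of "\<Union>u\<in>B. F u"]) auto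
qed

lemma eig_span_insertE:
  assumes "u \<in> eig_span (insert \<mu> F)"
  obtains x y where "u = x + y" "x \<in> eigenspace a f \<mu>" "y \<in> eig_span F"
proof -
  have "eig_span (insert \<mu> F) = span (eigenspace a f \<mu> \<union> (\<Union>\<nu>\<in>F. eigenspace a f \<nu>))"
    by (simp add: eig_span_def)
  moreover have "span (eigenspace a f \<mu>) = eigenspace a f \<mu>"
    using subspace_eigenspace by (simp add: span_eq_iff)
  ultimately show thesis using assms that by (auto simp add: span_Un simp flip: eig_span_def)
qed

text \<open>On a single eigenspace with \<open>\<nu>\<close> in \<open>{\<mu>..<0}\<close> one has
  \<open>a = \<nu> f\<close> and \<open>f \<le> 0\<close>, so replacing \<open>\<nu>\<close> by the
  smaller \<open>\<mu>\<close> can only increase the right-hand side. Distinct eigenspaces are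
  orthogonal for both forms, so the inequalities add up.\<close>

lemma eig_span_form_le:
  assumes "\<mu> < 0" "u \<in> eig_span {\<mu>..<0}"
  shows "a u u \<le> \<mu> * f u u"
proof -
  have "u \<in> eig_span F \<Longrightarrow> a u u \<le> \<mu> * f u u" if "finite F" "F \<subseteq> {\<mu>..<0}" for F
    using that
  proof (induction F arbitrary: u rule: finite_induct)
    case empty
    then show ?case by (simp add: eig_span_def bil_simps)
  next
    case (insert \<nu> F)
    obtain x y where xy: "u = x + y" "x \<in> eigenspace a f \<nu>" "y \<in> eig_span F"
      using eig_span_insertE insert.prems(1) by blast
    have orth: "a x y = 0" "f x y = 0"
      using eigenvector_orthogonal_eig_span[OF xy(2,3)] insert.hyps by auto
    have \<nu>: "\<mu> \<le> \<nu>" "\<nu> < 0" using insert.prems(2) by auto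
    have ax: "a x x = \<nu> * f x x" using xy(2) by (simp add: eigenspace_def)
    have "0 \<le> a x x" using xy(2) \<nu> eigenspace_subset_S[of \<nu>] a_nonneg by auto
    then have "f x x \<le> 0" using ax \<nu> by (simp add: zero_le_mult_iff)
    then have "a x x \<le> \<mu> * f x x" using ax \<nu> by (simp add: mult_right_mono_neg)
    moreover have "a y y \<le> \<mu> * f y y" using insert.IH[of y] xy insert.prems by auto
    ultimately show ?case
      using orth sym[of y x] by (simp add: xy(1) bil_simps algebra_simps)
  qed
  moreover obtain F where "finite F" "F \<subseteq> {\<mu>..<0}" "{u} \<subseteq> eig_span F"
    using eig_span_finite_cases[of "{u}" "{\<mu>..<0}"] assms(2) by auto
  ultimately show ?thesis by auto
qed

text \<open>An infinite-dimensional such subspace would contain an orthonormal sequence, which converges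
  weakly to 0 although the form is bounded away from 0 along it.\<close>

lemma edim_finite_if_form_le:
  assumes V: "subspace V" "V \<subseteq> S" and "\<mu> < 0" and le: "\<And>u. u \<in> V \<Longrightarrow> a u u \<le> \<mu> * f u u"
  shows "edim V < \<infinity>"
proof (rule ccontr)
  assume "\<not> edim V < \<infinity>"
  then have "edim V = \<infinity>" by simp
  \<comment> \<open>\<open>P e n u\<close> says that \<open>u\<close> is an admissible
    \<open>n\<close>-th term of an orthonormal sequence in \<open>V\<close> whose earlier terms are
    given by \<open>e\<close>.\<close>
  define P where "P e n u \<longleftrightarrow> u \<in> V \<and> norm u = 1 \<and> (\<forall>k<n. u \<bullet> e k = 0)"
    for e and n :: nat and u :: 'a
  have "\<exists>e. \<forall>n. P e n (e n)"
  proof (rule dependent_wellorder_choice)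
    show "P e n u = P e' n u" if "\<And>k. k < n \<Longrightarrow> e k = e' k" for u e e' and n :: nat
      using that by (auto simp: P_def)
  next
    fix n :: nat and e :: "nat \<Rightarrow> 'a"
    \<comment> \<open>The \<open>n\<close> earlier terms cannot exhaust \<open>n + 1\<close>
      dimensions, so a nonzero vector orthogonal to them is left to normalize.\<close>
    obtain B where B: "finite B" "B \<subseteq> V" "independent B" "card B = Suc n"
      using le_edimE[of "Suc n" V] \<open>edim V = \<infinity>\<close> by auto
    have "card (e ` {..<n}) < card B"
      using B(4) card_image_le[of "{..<n}" e] by simp
    moreover have "bilinear (\<lambda>u v :: 'a. u \<bullet> v)"
      by (auto simp: bilinear_def inner_add intro!: linearI)
    ultimately obtain u where u: "u \<in> span B" "u \<noteq> 0" "\<And>x. x \<in> span (e ` {..<n}) \<Longrightarrow> u \<bullet> x = 0"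
      using exists_orthogonal_to_span[of "\<lambda>u v. u \<bullet> v" "e ` {..<n}" B] B(1,3) by auto
    have "u \<in> V" using u(1) B(2) V(1) span_minimal by blast
    moreover have "u \<bullet> e k = 0" if "k < n" for k
      using u(3)[of "e k"] that by (auto intro: span_base)
    ultimately show "\<exists>u. P e n u"
      using u(2) V(1) by (intro exI[of _ "(1 / norm u) *\<^sub>R u"]) (auto simp: P_def subspace_scale)
  qed
  then obtain e :: "nat \<Rightarrow> 'a" where e: "\<And>n. e n \<in> V" "\<And>n. norm (e n) = 1" "\<And>n k. k < n \<Longrightarrow> e n \<bullet> e k = 0"
    unfolding P_def by auto
  obtain r l where r: "strict_mono r" "weakly_converges (e \<circ> r) l"
    using bounded_weakly_convergent_subsequence[of e 1] e(2) by auto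
  have lim: "(\<lambda>n. e (r n) \<bullet> v) \<longlonglongrightarrow> l \<bullet> v" for v
    using r(2) by (simp add: weakly_converges_def)
  have "l \<bullet> e k = 0" for k
  proof -
    have "\<forall>\<^sub>F n in sequentially. e (r n) \<bullet> e k = 0"
      using eventually_gt_at_top[of k]
      by (rule eventually_mono) (meson e(3) less_le_trans seq_suble[OF r(1)])
    then have "(\<lambda>n. e (r n) \<bullet> e k) \<longlonglongrightarrow> 0" by (rule tendsto_eventually)
    then show ?thesis using lim LIMSEQ_unique by blast
  qed
  \<comment> \<open>All terms of the sequence are orthogonal to \<open>l\<close>; testing the weak
    convergence against \<open>l\<close> itself gives \<open>l \<bullet> l = 0\<close>.\<close>
  then have "(\<lambda>n. 0) \<longlonglongrightarrow> l \<bullet> l" using lim[of l] by (simp add: inner_commute)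
  then have "l = 0" by (simp add: LIMSEQ_const_iff)
  then have "(\<lambda>n. f (e (r n)) (e (r n))) \<longlonglongrightarrow> 0"
    using weakly_seq_continuousD[OF f_cont r(2) r(2)] by (simp add: bil_simps)
  then have "(\<lambda>n. \<mu> * f (e (r n)) (e (r n))) \<longlonglongrightarrow> \<mu> * 0" by (rule tendsto_mult_left)
  moreover obtain \<gamma> where \<gamma>: "\<gamma> > 0" "\<And>u. u \<in> S \<Longrightarrow> \<gamma> * (norm u)\<^sup>2 \<le> a u u"
    by (rule obtain_coercivity) blast
  have "\<gamma> \<le> \<mu> * f (e n) (e n)" for n
    using \<gamma>(2)[of "e n"] le[of "e n"] e(1,2)[of n] V(2) by auto
  ultimately have "\<gamma> \<le> \<mu> * 0" by (intro LIMSEQ_le_const) auto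
  then show False using \<gamma>(1) by simp
qed

section \<open>Counting eigenvalues by dimension\<close>

lemma edim_eig_span_finite: "\<mu> < 0 \<Longrightarrow> edim (eig_span {\<mu>..<0}) < \<infinity>"
  by (intro edim_finite_if_form_le[of _ \<mu>] subspace_eig_span eig_span_subset_S)
    (auto intro: eig_span_form_le)

lemma eigenspace_subset_eig_span: "\<mu> \<in> I \<Longrightarrow> eigenspace a f \<mu> \<subseteq> eig_span I"
  by (auto simp: eig_span_def intro: span_base)

lemma edim_eigenspace_finite: "\<mu> < 0 \<Longrightarrow> edim (eigenspace a f \<mu>) < \<infinity>"
  using edim_eig_span_finite[of \<mu>] edim_mono[OF eigenspace_subset_eig_span[of \<mu> "{\<mu>..<0}"]]
  by (meson atLeastLessThan_iff le_less_trans order_refl)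

text \<open>The sum of the eigenspaces is direct: a common vector of one eigenspace and the span of
  the others would be \<open>a\<close>-orthogonal to itself, while \<open>a\<close> is positive
  definite on \<open>S\<close>.\<close>

lemma edim_eig_span_finite_set:
  assumes "finite F" "F \<subseteq> {..<0}"
  shows "edim (eig_span F) = (\<Sum>\<mu>\<in>F. edim (eigenspace a f \<mu>)) \<and> edim (eig_span F) < \<infinity>"
  using assms
proof (induction F rule: finite_induct)
  case empty
  show ?case using edim_span[of "{}::'a set"] by (simp add: eig_span_def zero_enat_def independent_empty)
next
  case (insert \<mu> F)
  have "\<mu> < 0" using insert.prems by auto
  have "eig_span (insert \<mu> F) = span (eigenspace a f \<mu> \<union> eig_span F)"
    unfolding eig_span_def by (simp only: span_Un span_span UN_insert)
  moreover have "eigenspace a f \<mu> \<inter> eig_span F = {0}"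
  proof -
    have "u = 0" if "u \<in> eigenspace a f \<mu>" "u \<in> eig_span F" for u
    proof (rule ccontr)
      assume "u \<noteq> 0"
      then have "0 < a u u" using a_pos that(1) eigenspace_subset_S[of \<mu>] \<open>\<mu> < 0\<close> by auto
      then show False using eigenvector_orthogonal_eig_span(1)[OF that] insert.hyps by simp
    qed
    then show ?thesis
      using subspace_0[OF subspace_eigenspace] subspace_0[OF subspace_eig_span] by auto
  qed
  ultimately have "edim (eig_span (insert \<mu> F)) = edim (eigenspace a f \<mu>) + edim (eig_span F)"
    using insert.IH insert.prems edim_eigenspace_finite[OF \<open>\<mu> < 0\<close>]
      edim_span_Un[OF subspace_eigenspace[of \<mu>] subspace_eig_span[of F]]
    by (metis insert_subset)
  moreover have "edim (eigenspace a f \<mu>) + edim (eig_span F) < \<infinity>"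
    using insert.IH insert.prems edim_eigenspace_finite[OF \<open>\<mu> < 0\<close>]
    by (metis enat_ord_simps(4) insert_subset plus_eq_infty_iff_enat)
  ultimately show ?case using insert by auto
qed

lemma eigenvalue_count_eq_edim:
  assumes "I \<subseteq> {..<0}"
  shows "eigenvalue_count a f I = edim (eig_span I)"
proof (rule antisym)
  show "eigenvalue_count a f I \<le> edim (eig_span I)"
    unfolding eigenvalue_count_def
  proof (rule SUP_least)
    fix F assume F: "F \<in> {F. finite F \<and> F \<subseteq> {\<mu>\<in>I. is_eigenvalue a f \<mu>}}"
    then have "F \<subseteq> I" by auto
    then have "(\<Sum>\<mu>\<in>F. edim (eigenspace a f \<mu>)) = edim (eig_span F)"
      using F assms edim_eig_span_finite_set[of F] by auto
    then show "(\<Sum>\<mu>\<in>F. edim (eigenspace a f \<mu>)) \<le> edim (eig_span I)"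
      using \<open>F \<subseteq> I\<close> by (simp add: edim_mono eig_span_mono)
  qed
  show "edim (eig_span I) \<le> eigenvalue_count a f I"
    unfolding edim_def
  proof (rule SUP_least)
    fix B assume B: "B \<in> {B. finite B \<and> B \<subseteq> eig_span I \<and> independent B}"
    then obtain F where F: "finite F" "F \<subseteq> I" "B \<subseteq> eig_span F"
      using eig_span_finite_cases by blast
    define G where "G = {\<mu>\<in>F. is_eigenvalue a f \<mu>}"
    have "eigenspace a f \<mu> \<subseteq> eig_span G" if "\<mu> \<in> F" for \<mu>
    proof (cases "\<mu> \<in> G")
      case False
      then have "eigenspace a f \<mu> \<subseteq> {0}" using that by (auto simp: G_def is_eigenvalue_def)
      then show ?thesis using subspace_0[OF subspace_eig_span] by auto
    qed (rule eigenspace_subset_eig_span)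
    then have "eig_span F \<subseteq> eig_span G"
      unfolding eig_span_def[of F] by (intro span_minimal subspace_eig_span) auto
    then have "enat (card B) \<le> edim (eig_span G)"
      using B F by (intro card_le_edim) auto
    also have "\<dots> = (\<Sum>\<mu>\<in>G. edim (eigenspace a f \<mu>))"
      using F assms by (intro conjunct1[OF edim_eig_span_finite_set]) (auto simp: G_def)
    also have "\<dots> \<le> eigenvalue_count a f I"
      unfolding eigenvalue_count_def using F by (intro SUP_upper) (auto simp: G_def)
    finally show "enat (card B) \<le> eigenvalue_count a f I" .
  qed
qed

section \<open>Minimizing the Rayleigh quotient\<close>

lemma constrained_minimizer:
  assumes W: "subspace W" "W \<subseteq> S"
    and closed: "\<And>x l. (\<And>n. x n \<in> W) \<Longrightarrow> weakly_converges x l \<Longrightarrow> l \<in> W"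
    and u0: "u0 \<in> W" "f u0 u0 < 0"
  obtains w m where "w \<in> W" "f w w < 0" "m < 0" "f w w = m * a w w"
    "\<And>v. v \<in> W \<Longrightarrow> m * a v v \<le> f v v"
proof -
  obtain \<gamma> where \<gamma>: "\<gamma> > 0" "\<And>u. u \<in> S \<Longrightarrow> \<gamma> * (norm u)\<^sup>2 \<le> a u u"
    by (rule obtain_coercivity) blast
  obtain Ma where Ma: "Ma > 0" "\<And>u v. \<bar>a u v\<bar> \<le> Ma * norm u * norm v"
    using continuous_bilinear_bounded[OF bil(1) a_cont] by blast
  obtain Mf where Mf: "Mf > 0" "\<And>u v. \<bar>f u v\<bar> \<le> Mf * norm u * norm v"
    using weakly_seq_continuous_bilinear_bounded[OF bil(2) f_cont] by blast
  \<comment> \<open>The constraint is \<open>a w w \<le> 1\<close> and not \<open>a w w = 1\<close>,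
    because only the inequality survives a weak limit.\<close>
  define D where "D = {w\<in>W. a w w \<le> 1}"
  define m where "m = Inf ((\<lambda>w. f w w) ` D)"
  have norm_D: "(norm w)\<^sup>2 \<le> 1 / \<gamma>" if "w \<in> D" for w
  proof -
    have "\<gamma> * (norm w)\<^sup>2 \<le> 1" using \<gamma>(2)[of w] that W(2) by (auto simp: D_def)
    then show ?thesis using \<gamma>(1) by (simp add: field_simps)
  qed
  have "- (Mf * (1 / \<gamma>)) \<le> f w w" if "w \<in> D" for w
  proof -
    have "\<bar>f w w\<bar> \<le> Mf * (norm w)\<^sup>2"
      using Mf(2)[of w w] by (simp add: power2_eq_square mult.assoc)
    also have "\<dots> \<le> Mf * (1 / \<gamma>)" using norm_D[OF that] Mf(1) by (intro mult_left_mono) auto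
    finally show ?thesis by linarith
  qed
  then have bdd: "bdd_below ((\<lambda>w. f w w) ` D)" by (rule bdd_belowI2)
  then have m_le: "m \<le> f w w" if "w \<in> D" for w
    using that unfolding m_def by (intro cInf_lower) auto
  have normalize: "(1 / sqrt (a v v)) *\<^sub>R v \<in> D"
      "f ((1 / sqrt (a v v)) *\<^sub>R v) ((1 / sqrt (a v v)) *\<^sub>R v) = f v v / a v v"
    if "v \<in> W" "v \<noteq> 0" for v
  proof -
    have "0 < a v v" using that W(2) a_pos by auto
    then have sq: "sqrt (a v v) * sqrt (a v v) = a v v" by simp
    then show "f ((1 / sqrt (a v v)) *\<^sub>R v) ((1 / sqrt (a v v)) *\<^sub>R v) = f v v / a v v"
      using \<open>0 < a v v\<close> by (simp add: bil_simps field_simps)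
    have "a ((1 / sqrt (a v v)) *\<^sub>R v) ((1 / sqrt (a v v)) *\<^sub>R v) = 1"
      using sq \<open>0 < a v v\<close> by (simp add: bil_simps field_simps)
    then show "(1 / sqrt (a v v)) *\<^sub>R v \<in> D"
      using that W(1) by (simp add: D_def subspace_scale)
  qed
  have ineq: "m * a v v \<le> f v v" if "v \<in> W" for v
  proof (cases "v = 0")
    case False
    have "0 < a v v" using that False W(2) a_pos by auto
    moreover have "m \<le> f v v / a v v"
      using m_le normalize[OF that False] by metis
    ultimately show ?thesis by (simp add: le_divide_eq)
  qed (simp add: bil_simps)
  have "u0 \<noteq> 0" using u0(2) by (auto simp: bil_simps)
  then have "0 < a u0 u0" using u0(1) W(2) a_pos by auto
  then have "f u0 u0 / a u0 u0 < 0" using u0(2) by (simp add: divide_neg_pos)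
  then have "m < 0"
    using m_le normalize[OF u0(1) \<open>u0 \<noteq> 0\<close>] by (metis le_less_trans)
  have "D \<noteq> {}" using normalize(1)[OF u0(1) \<open>u0 \<noteq> 0\<close>] by auto
  then have "\<exists>w\<in>D. f w w < m + inverse (Suc n)" for n
    using cInf_lessD[of "(\<lambda>w. f w w) ` D" "m + inverse (Suc n)"] unfolding m_def by auto
  then obtain x where x: "\<And>n. x n \<in> D" "\<And>n. f (x n) (x n) < m + inverse (Suc n)"
    by metis
  have "norm (x n) \<le> sqrt (1 / \<gamma>)" for n
    using norm_D[OF x(1)] by (rule real_le_rsqrt)
  then obtain r l where r: "strict_mono r" "weakly_converges (x \<circ> r) l"
    using bounded_weakly_convergent_subsequence by blast
  have "l \<in> W" using closed[OF _ r(2)] x(1) by (auto simp: D_def)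
  \<comment> \<open>Weak lower semicontinuity of \<open>a\<close>: nonnegativity of
    \<open>a (x - l) (x - l)\<close> gives \<open>2 * a x l - a l l \<le> a x x \<le> 1\<close>,
    whose left side is affine in \<open>x\<close> and passes to the limit.\<close>
  have "(\<lambda>n. a (x (r n)) l) \<longlonglongrightarrow> a l l"
  proof -
    have "linear (\<lambda>u. a u l)" using bil(1) by (simp add: bilinear_def)
    moreover have "\<bar>a u l\<bar> \<le> (Ma * norm l) * norm u" for u
      using Ma(2)[of u l] by (simp add: mult_ac)
    ultimately show ?thesis
      using bounded_functional_weakly_continuous[OF _ _ r(2)] by (auto simp: o_def)
  qed
  then have "(\<lambda>n. 2 * a (x (r n)) l - a l l) \<longlonglongrightarrow> 2 * a l l - a l l"
    by (intro tendsto_intros)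
  moreover have "2 * a (x (r n)) l - a l l \<le> 1" for n
  proof -
    have "x (r n) \<in> W" "a (x (r n)) (x (r n)) \<le> 1" using x(1) by (auto simp: D_def)
    moreover from this(1) have "0 \<le> a (x (r n) - l) (x (r n) - l)"
      using \<open>l \<in> W\<close> W by (intro a_nonneg) (auto simp: subspace_diff)
    ultimately show ?thesis using sym(1)[of l "x (r n)"] by (simp add: bil_simps)
  qed
  ultimately have "2 * a l l - a l l \<le> 1" by (intro LIMSEQ_le_const2) auto
  then have al: "a l l \<le> 1" by simp
  have "(\<lambda>n. f (x (r n)) (x (r n))) \<longlonglongrightarrow> f l l"
    using weakly_seq_continuousD[OF f_cont r(2) r(2)] by simp
  moreover have "(\<lambda>n. m + inverse (real (Suc (r n)))) \<longlonglongrightarrow> m + 0"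
    using LIMSEQ_subseq_LIMSEQ[OF LIMSEQ_inverse_real_of_nat r(1)]
    by (intro tendsto_add tendsto_const) (simp add: o_def)
  ultimately have "f l l \<le> m + 0"
    using x(2) by (intro LIMSEQ_le) (auto intro: less_imp_le)
  moreover have "m \<le> f l l" using m_le \<open>l \<in> W\<close> al by (simp add: D_def)
  ultimately have fl: "f l l = m" by simp
  \<comment> \<open>The constraint is active: \<open>m\<close> is negative, so
    \<open>m * a l l \<le> m\<close> forces \<open>a l l \<ge> 1\<close>.\<close>
  have "m * a l l \<le> m * 1" using ineq[OF \<open>l \<in> W\<close>] fl by simp
  then have "a l l = 1" using \<open>m < 0\<close> al by (simp add: mult_le_cancel_left)
  then show thesis
    using that[of l m] \<open>l \<in> W\<close> fl \<open>m < 0\<close> ineq by simp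
qed

text \<open>If the subspace were larger, it would meet the orthogonal complement of the eigenspaces, and
  minimizing the Rayleigh quotient there would produce a further eigenvalue in the interval.\<close>

lemma card_le_edim_eig_span:
  assumes "\<mu> < 0" and B: "finite B" "independent B" "span B \<subseteq> S"
    and le: "\<And>u. u \<in> span B \<Longrightarrow> a u u \<le> \<mu> * f u u"
  shows "enat (card B) \<le> edim (eig_span {\<mu>..<0})"
proof (rule ccontr)
  assume "\<not> ?thesis"
  then have small: "edim (eig_span {\<mu>..<0}) < enat (card B)" by simp
  define G where "G = (\<Union>\<nu>\<in>{\<mu>..<0}. eigenspace a f \<nu>)"
  have E: "eig_span {\<mu>..<0} = span G" by (simp add: eig_span_def G_def)
  obtain TE where TE: "finite TE" "span TE = span G" "card TE < card B"
    using finite_edim_basis[OF subspace_eig_span edim_eig_span_finite[OF \<open>\<mu> < 0\<close>]] small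
    by (metis E enat_ord_simps(2))
  obtain TK where TK: "finite TK" "span TK = form_ker a"
    using finite_edim_basis[OF subspace_form_ker[OF bil(1)] ker_finite] by metis
  \<comment> \<open>\<open>u\<close> serves twice: it shows that the infimum over \<open>W\<close>
    is negative, and its quotient bounds the new eigenvalue from below by
    \<open>\<mu>\<close>.\<close>
  obtain u where u: "u \<in> span B" "u \<noteq> 0" "\<And>x. x \<in> span G \<Longrightarrow> a u x = 0"
    using exists_orthogonal_to_span[OF bil(1) TE(1) B(1,2) TE(3)] TE(2) by metis
  \<comment> \<open>On \<open>G\<close> orthogonality for \<open>f\<close> and for \<open>a\<close>
    coincide, as the eigenvalues are nonzero. On the kernel of \<open>a\<close> only
    \<open>f\<close>-orthogonality is a condition.\<close>
  define W where "W = {w. \<forall>z\<in>form_ker a \<union> G. f w z = 0}"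
  have "W \<subseteq> S" by (auto simp: W_def S_def)
  have "subspace W" unfolding W_def by (rule subspace_form_orthogonal[OF bil(2)])
  have eq_a: "a w z = 0" if wz: "w \<in> W" "z \<in> G" for w z
  proof -
    obtain \<nu> where "a z w = \<nu> * f z w" using wz(2) by (auto simp: G_def eigenspace_def)
    moreover have "f w z = 0" using that by (auto simp: W_def)
    ultimately show ?thesis using sym by simp
  qed
  have "u \<in> W"
  proof -
    have "f u z = 0" if z: "z \<in> G" for z
    proof -
      obtain \<nu> where "\<nu> < 0" "a z u = \<nu> * f z u" using z by (auto simp: G_def eigenspace_def)
      moreover have "a u z = 0" using u(3) that by (simp add: span_base)
      ultimately show ?thesis using sym by simp
    qed
    moreover have "u \<in> S" using u(1) B(3) by auto
    ultimately show ?thesis by (auto simp: W_def S_def)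
  qed
  have "0 < a u u" using \<open>u \<in> W\<close> \<open>W \<subseteq> S\<close> u(2) a_pos by auto
  then have "0 < \<mu> * f u u" using le[OF u(1)] by linarith
  then have "f u u < 0" using \<open>\<mu> < 0\<close> by (simp add: zero_less_mult_iff)
  have "l \<in> W" if "\<And>n. x n \<in> W" "weakly_converges x l" for x l
  proof -
    have "f l z = 0" if "z \<in> form_ker a \<union> G" for z
    proof -
      have "(\<lambda>n. f (x n) z) \<longlonglongrightarrow> f l z"
        by (rule weakly_seq_continuousD[OF f_cont \<open>weakly_converges x l\<close> weakly_converges_const])
      moreover have "f (x n) z = 0" for n
        using \<open>\<And>n. x n \<in> W\<close> \<open>z \<in> form_ker a \<union> G\<close> unfolding W_def by blast
      ultimately show ?thesis by (simp add: LIMSEQ_const_iff)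
    qed
    then show ?thesis by (simp add: W_def)
  qed
  then obtain w m where w: "w \<in> W" "f w w < 0" "m < 0" "f w w = m * a w w"
      and min: "\<And>v. v \<in> W \<Longrightarrow> m * a v v \<le> f v v"
    using constrained_minimizer[OF \<open>subspace W\<close> \<open>W \<subseteq> S\<close> _ \<open>u \<in> W\<close> \<open>f u u < 0\<close>] by metis
  \<comment> \<open>\<open>h\<close> is nonnegative on \<open>W\<close> and vanishes at the
    minimizer \<open>w\<close>, so \<open>w\<close> is \<open>h\<close>-orthogonal to
    \<open>W\<close>.\<close>
  define h where "h v v' = f v v' - m * a v v'" for v v'
  have "symmetric_bilinear h"
    unfolding symmetric_bilinear_def bilinear_def h_def
    using sym by (auto intro!: linearI simp: bil_simps algebra_simps)
  then have critical: "f w v = m * a w v" if "v \<in> W" for v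
    using nonneg_form_null_vector[of h W w v] \<open>subspace W\<close> w min that by (simp add: h_def)
  have span_U: "span (TK \<union> TE) = {k + e |k e. k \<in> form_ker a \<and> e \<in> span G}"
    by (simp add: span_Un TK TE)
  have f_neg_E: "f e e < 0" if "e \<in> span G" "e \<noteq> 0" for e
  proof -
    have "e \<in> S" using eig_span_subset_S[of "{\<mu>..<0}"] that(1) E by auto
    then have "0 < a e e" using that(2) a_pos by auto
    moreover have "a e e \<le> \<mu> * f e e" using eig_span_form_le[OF \<open>\<mu> < 0\<close>] that(1) E by auto
    ultimately have "0 < \<mu> * f e e" by linarith
    then show ?thesis using \<open>\<mu> < 0\<close> by (simp add: zero_less_mult_iff)
  qed
  \<comment> \<open>The kernel of \<open>a\<close> and the span of \<open>G\<close> are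
    \<open>f\<close>-orthogonal and \<open>f\<close> is negative definite on each, hence on their
    sum. This permits \<open>f\<close>-projection onto the sum.\<close>
  have nondeg: "f p p \<noteq> 0" if pU: "p \<in> span (TK \<union> TE)" "p \<noteq> 0" for p
  proof -
    obtain k e where p: "p = k + e" "k \<in> form_ker a" "e \<in> span G"
      using pU(1) span_U by auto
    have "e \<in> S" using eig_span_subset_S[of "{\<mu>..<0}"] p(3) E by auto
    then have "f e k = 0" using p(2) by (simp add: S_def)
    then have "f p p = f k k + f e e" using sym(2)[of k e] by (simp add: p(1) bil_simps)
    moreover have "f k k < 0 \<or> k = 0" "f e e < 0 \<or> e = 0"
      using f_neg_ker p f_neg_E by auto
    ultimately show ?thesis using pU(2) p(1) by (auto simp: bil_simps)
  qed
  \<comment> \<open>The equation is extended from \<open>W\<close> to all test vectors: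
    \<open>v - p\<close> lies in \<open>W\<close>, and on the projection \<open>p\<close> both sides
    vanish.\<close>
  have "f w v = m * a w v" for v
  proof -
    obtain p where p: "p \<in> span (TK \<union> TE)" "\<And>x. x \<in> span (TK \<union> TE) \<Longrightarrow> f (v - p) x = 0"
      using form_projection_onto_span[OF bil(2) finite_UnI[OF TK(1) TE(1)] nondeg] by metis
    have "form_ker a \<union> G \<subseteq> span (TK \<union> TE)"
      using TK(2) TE(2) span_mono[of TK "TK \<union> TE"] span_mono[of TE "TK \<union> TE"] span_superset[of G]
      by auto
    then have "v - p \<in> W" using p(2) by (auto simp: W_def)
    obtain k e where ke: "p = k + e" "k \<in> form_ker a" "e \<in> span G"
      using p(1) span_U by auto
    have "f w k = 0" using w(1) ke(2) by (auto simp: W_def)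
    moreover have "a w k = 0" using ke(2) sym(1)[of w k] by (simp add: form_ker_def)
    moreover have "f w e = 0"
      using w(1) by (intro linear_eq_0_on_span[OF linear_forms(2) _ ke(3)]) (auto simp: W_def)
    moreover have "a w e = 0"
      using w(1) eq_a by (intro linear_eq_0_on_span[OF linear_forms(1) _ ke(3)]) auto
    ultimately show ?thesis
      using critical[OF \<open>v - p \<in> W\<close>] by (simp add: ke(1) bil_simps)
  qed
  then have "w \<in> eigenspace a f (1 / m)" using w(3) by (simp add: eigenspace_def)
  \<comment> \<open>Minimality tested at \<open>u\<close> gives
    \<open>m \<le> f u u / a u u\<close>, and the assumed inequality bounds this quotient by
    \<open>1 / \<mu>\<close>.\<close>
  moreover have "1 / m \<in> {\<mu>..<0}"
  proof -
    have "a u u \<le> \<mu> * f u u" by (rule le[OF u(1)])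
    also have "\<dots> \<le> \<mu> * (m * a u u)"
      using min[OF \<open>u \<in> W\<close>] \<open>\<mu> < 0\<close> by (intro mult_left_mono_neg) auto
    finally have "1 * a u u \<le> (\<mu> * m) * a u u" by simp
    then have "1 \<le> \<mu> * m" using \<open>0 < a u u\<close> by simp
    then show ?thesis using w(3) by (simp add: divide_simps)
  qed
  \<comment> \<open>The new eigenvector is itself one of those to which \<open>W\<close> is
    \<open>f\<close>-orthogonal, contradicting \<open>f w w < 0\<close>.\<close>
  ultimately have "w \<in> G" unfolding G_def by blast
  then have "f w w = 0" using w(1) by (auto simp: W_def)
  then show False using w(2) by simp
qed

section \<open>The enumeration of the negative eigenvalues\<close>

lemma finite_eigenvalues:
  assumes "\<mu> < 0"
  shows "finite {\<nu>\<in>{\<mu>..<0}. is_eigenvalue a f \<nu>}"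
proof (rule ccontr)
  assume inf: "infinite {\<nu>\<in>{\<mu>..<0}. is_eigenvalue a f \<nu>}"
  obtain n where n: "edim (eig_span {\<mu>..<0}) = enat n"
    using edim_eig_span_finite[OF assms] by auto
  obtain F where F: "finite F" "card F = Suc n" "F \<subseteq> {\<nu>\<in>{\<mu>..<0}. is_eigenvalue a f \<nu>}"
    using infinite_arbitrarily_large[OF inf] by metis
  \<comment> \<open>Each eigenvalue contributes at least one dimension to a finite-dimensional
    span.\<close>
  have one: "1 \<le> edim (eigenspace a f \<nu>)" if \<nu>: "\<nu> \<in> F" for \<nu>
  proof -
    obtain u where "u \<noteq> 0" "u \<in> eigenspace a f \<nu>"
      using \<nu> F(3) by (auto simp: is_eigenvalue_def)
    then have "enat (card {u}) \<le> edim (eigenspace a f \<nu>)"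
      by (intro card_le_edim) (auto simp: dependent_single)
    then show ?thesis unfolding one_enat_def by simp
  qed
  have "enat (Suc n) = (\<Sum>\<nu>\<in>F. 1)" using F(2) by (simp add: of_nat_eq_enat)
  also have "\<dots> \<le> (\<Sum>\<nu>\<in>F. edim (eigenspace a f \<nu>))" using one by (rule sum_mono)
  also have "\<dots> = edim (eig_span F)" using F by (subst edim_eig_span_finite_set) auto
  also have "\<dots> \<le> edim (eig_span {\<mu>..<0})"
    using F(3) by (intro edim_mono eig_span_mono) auto
  also have "\<dots> = enat n" by (rule n)
  finally show False by simp
qed

text \<open>The count over \<open>{\<nu>..<0}\<close> jumps only at eigenvalues, of which finitely
  many lie in \<open>{\<mu>..<0}\<close>. The \<open>j\<close>-th one is the largest eigenvalue at
  which the count reaches \<open>j\<close>; multiplicities may make it exceed \<open>j\<close>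
  there.\<close>

lemma neg_eigenvalue_ge_if_count:
  assumes "\<mu> < 0" "1 \<le> j" "enat j \<le> eigenvalue_count a f {\<mu>..<0}"
  obtains \<nu> where "\<mu> \<le> \<nu>" "is_neg_eigenvalue a f j \<nu>"
proof -
  have count_cong: "eigenvalue_count a f I = eigenvalue_count a f J"
    if "{\<mu>\<in>I. is_eigenvalue a f \<mu>} = {\<mu>\<in>J. is_eigenvalue a f \<mu>}" for I J
    using that by (simp add: eigenvalue_count_def)
  define \<Lambda> where "\<Lambda> = {\<nu>\<in>{\<mu>..<0}. is_eigenvalue a f \<nu>}"
  \<comment> \<open>An interval ending at 0, with open or closed lower end, may be cut off at its
    least eigenvalue without losing any.\<close>
  have count_Min: "eigenvalue_count a f I = eigenvalue_count a f {Min X..<0}"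
    if X: "X = {\<nu>\<in>I. is_eigenvalue a f \<nu>}" "X \<noteq> {}" "finite X"
      and I: "I \<subseteq> {..<0}" "\<And>x y. x \<in> I \<Longrightarrow> x < y \<Longrightarrow> y < 0 \<Longrightarrow> y \<in> I" for I X
  proof (rule count_cong)
    have "Min X \<in> I" using X Min_in by blast
    have "Min X \<le> \<nu>" if "\<nu> \<in> X" for \<nu> using X(3) that by simp
    then have "\<nu> \<in> I \<longleftrightarrow> \<nu> \<in> {Min X..<0}" if "is_eigenvalue a f \<nu>" for \<nu>
      using that X(1) I(1) I(2)[OF \<open>Min X \<in> I\<close>, of \<nu>] \<open>Min X \<in> I\<close>
      by (cases "\<nu> = Min X") auto
    then show "{\<mu>\<in>I. is_eigenvalue a f \<mu>} = {\<nu>\<in>{Min X..<0}. is_eigenvalue a f \<nu>}" by blast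
  qed
  have count_empty: "eigenvalue_count a f I = 0" if "{\<nu>\<in>I. is_eigenvalue a f \<nu>} = {}" for I
    unfolding eigenvalue_count_def that by (simp add: bot_enat_def)
  have "finite \<Lambda>" unfolding \<Lambda>_def by (rule finite_eigenvalues[OF assms(1)])
  have "\<Lambda> \<noteq> {}"
  proof
    assume "\<Lambda> = {}"
    then have "eigenvalue_count a f {\<mu>..<0} = 0" by (intro count_empty) (simp only: \<Lambda>_def)
    then show False using assms(2,3) by (simp add: enat_0_iff)
  qed
  define G where "G = {\<nu>\<in>\<Lambda>. enat j \<le> eigenvalue_count a f {\<nu>..<0}}"
  have "eigenvalue_count a f {\<mu>..<0} = eigenvalue_count a f {Min \<Lambda>..<0}"
    using \<open>finite \<Lambda>\<close> \<open>\<Lambda> \<noteq> {}\<close> by (intro count_Min) (auto simp: \<Lambda>_def)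
  moreover have "Min \<Lambda> \<in> \<Lambda>" using \<open>finite \<Lambda>\<close> \<open>\<Lambda> \<noteq> {}\<close> by simp
  ultimately have "Min \<Lambda> \<in> G" using assms(3) by (simp add: G_def)
  then have G: "finite G" "G \<noteq> {}" using \<open>finite \<Lambda>\<close> by (auto simp: G_def)
  define \<nu> where "\<nu> = Max G"
  have "\<nu> \<in> G" using G by (simp add: \<nu>_def)
  then have \<nu>: "\<nu> \<in> \<Lambda>" "enat j \<le> eigenvalue_count a f {\<nu>..<0}" by (auto simp: G_def)
  have "eigenvalue_count a f {\<nu><..<0} < enat j"
  proof (cases "{\<xi>\<in>{\<nu><..<0}. is_eigenvalue a f \<xi>} = {}")
    case True
    then show ?thesis using count_empty[of "{\<nu><..<0}"] assms(2) by (simp add: zero_enat_def)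
  next
    case False
    \<comment> \<open>\<open>Min X\<close> is the next eigenvalue above \<open>\<nu>\<close>. By
      maximality of \<open>\<nu>\<close> the count from there on has not yet reached
      \<open>j\<close>.\<close>
    define X where "X = {\<xi>\<in>{\<nu><..<0}. is_eigenvalue a f \<xi>}"
    have "X \<subseteq> \<Lambda>" using \<nu>(1) by (auto simp: X_def \<Lambda>_def)
    then have "finite X" "X \<noteq> {}"
      using \<open>finite \<Lambda>\<close> False by (auto simp: X_def intro: finite_subset)
    then have "Min X \<in> X" by simp
    then have "\<nu> < Min X" "Min X \<in> \<Lambda>" using \<open>X \<subseteq> \<Lambda>\<close> by (auto simp: X_def)
    then have "Min X \<notin> G" using G(1) by (auto simp: \<nu>_def not_le[symmetric])
    moreover have "eigenvalue_count a f {\<nu><..<0} = eigenvalue_count a f {Min X..<0}"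
      using \<open>finite X\<close> \<open>X \<noteq> {}\<close> by (intro count_Min) (auto simp: X_def)
    ultimately show ?thesis using \<open>Min X \<in> \<Lambda>\<close> by (simp add: G_def)
  qed
  then show thesis using \<nu> by (intro that[of \<nu>]) (auto simp: is_neg_eigenvalue_def \<Lambda>_def)
qed

text \<open>One half of the min-max principle: a test subspace bounds the \<open>j\<close>-th
  negative eigenvalue from below.\<close>

lemma neg_eigenvalue_ge_if_form_le:
  assumes "\<mu> < 0" "1 \<le> j" "j \<le> card B" "finite B" "independent B" "span B \<subseteq> S"
    and "\<And>u. u \<in> span B \<Longrightarrow> a u u \<le> \<mu> * f u u"
  obtains \<nu> where "\<mu> \<le> \<nu>" "is_neg_eigenvalue a f j \<nu>"
proof (rule neg_eigenvalue_ge_if_count[OF assms(1,2)])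
  have "enat j \<le> enat (card B)" using assms(3) by simp
  also have "\<dots> \<le> edim (eig_span {\<mu>..<0})" using assms by (intro card_le_edim_eig_span)
  also have "\<dots> = eigenvalue_count a f {\<mu>..<0}" by (rule eigenvalue_count_eq_edim[symmetric]) auto
  finally show "enat j \<le> eigenvalue_count a f {\<mu>..<0}" .
qed (rule that)

text \<open>The other half of the min-max principle: eigenvectors provide a test subspace for the
  eigenvalue itself.\<close>

lemma neg_eigenvalueD:
  assumes "is_neg_eigenvalue a f j \<mu>"
  obtains B where "finite B" "independent B" "card B = j"
    "\<And>u. u \<in> span B \<Longrightarrow> a u u \<le> \<mu> * f u u"
proof -
  have "\<mu> < 0" using assms by (simp add: is_neg_eigenvalue_def)
  have "enat j \<le> edim (eig_span {\<mu>..<0})"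
    using assms by (subst eigenvalue_count_eq_edim[symmetric]) (auto simp: is_neg_eigenvalue_def)
  then obtain B where B: "finite B" "B \<subseteq> eig_span {\<mu>..<0}" "independent B" "card B = j"
    using le_edimE by metis
  have "span B \<subseteq> eig_span {\<mu>..<0}" using B(2) subspace_eig_span by (rule span_minimal)
  then show thesis using that B eig_span_form_le[OF \<open>\<mu> < 0\<close>] by blast
qed

end

section \<open>Pencils with large parameter\<close>

lemma symmetric_bilinear_pencil:
  assumes "symmetric_bilinear b" "symmetric_bilinear c"
  shows "symmetric_bilinear (pencil b c t)"
proof -
  have bil: "bilinear b" "bilinear c" and sym: "\<And>u v. b u v = b v u" "\<And>u v. c u v = c v u"
    using assms by (auto simp: symmetric_bilinear_def)
  have "linear (pencil b c t u)" for u
    by (rule linearI)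
      (simp_all add: pencil_def bilinear_radd[OF bil(1)] bilinear_radd[OF bil(2)]
        bilinear_rmul[OF bil(1)] bilinear_rmul[OF bil(2)] algebra_simps)
  moreover have "linear (\<lambda>u. pencil b c t u v)" for v
    by (rule linearI)
      (simp_all add: pencil_def bilinear_ladd[OF bil(1)] bilinear_ladd[OF bil(2)]
        bilinear_lmul[OF bil(1)] bilinear_lmul[OF bil(2)] algebra_simps)
  moreover have "pencil b c t u v = pencil b c t v u" for u v
    using sym(1)[of u v] sym(2)[of u v] by (simp add: pencil_def)
  ultimately show ?thesis by (simp add: symmetric_bilinear_def bilinear_def)
qed

lemma weakly_seq_continuous_pencil:
  assumes "weakly_seq_continuous b" "weakly_seq_continuous c"
  shows "weakly_seq_continuous (pencil b c t)"
  unfolding weakly_seq_continuous_def pencil_def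
  using weakly_seq_continuousD[OF assms(1)] weakly_seq_continuousD[OF assms(2)]
  by (auto intro!: tendsto_diff tendsto_mult_left)

lemma nonneg_form_ker:
  assumes "symmetric_bilinear c" "\<And>v. 0 \<le> c v v" "c u u = 0"
  shows "u \<in> form_ker c"
  using nonneg_form_null_vector[OF assms(1) subspace_UNIV] assms(2,3) by (simp add: form_ker_def)

lemma form_ker_coercive:
  assumes "coercive_on UNIV a" "bilinear a"
  shows "form_ker a = {0}"
proof -
  obtain \<gamma> where \<gamma>: "\<gamma> > 0" "\<And>u. \<gamma> * (norm u)\<^sup>2 \<le> a u u"
    using assms(1) by (auto simp: coercive_on_def)
  have "u = 0" if "u \<in> form_ker a" for u
  proof -
    have "\<gamma> * (norm u)\<^sup>2 \<le> 0" using \<gamma>(2)[of u] that by (simp add: form_ker_def)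
    then show ?thesis using \<gamma>(1) by (simp add: mult_le_0_iff)
  qed
  moreover have "0 \<in> form_ker a" using assms(2) by (simp add: form_ker_def bilinear_lzero)
  ultimately show ?thesis by auto
qed

lemma edim_zero: "edim {0} = 0"
  using edim_span[of "{}"] by (simp add: independent_empty zero_enat_def)

lemma fixed_imp_moving:
  assumes "fixed_conditions a b c" "symmetric_bilinear a" "symmetric_bilinear c"
  shows "moving_conditions a b c"
proof -
  have ker: "form_ker a = {0}"
    using assms by (intro form_ker_coercive) (auto simp: fixed_conditions_def symmetric_bilinear_def)
  have "0 \<in> form_ker c"
    using assms(3) by (intro subspace_0 subspace_form_ker) (simp add: symmetric_bilinear_def)
  then show ?thesis
    using assms(1) unfolding fixed_conditions_def moving_conditions_def ker
    by (auto simp: edim_zero coercive_on_def)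
qed

section \<open>The locale assumptions for the pencil\<close>

lemma fixed_coercive_pencil:
  fixes a b c :: "'a::{real_inner,complete_space} \<Rightarrow> 'a \<Rightarrow> real"
  assumes "fixed_conditions a b c"
    and "symmetric_bilinear a" "symmetric_bilinear b" "symmetric_bilinear c"
  shows "coercive_pencil a (pencil b c t)"
proof
  have ker: "form_ker a = {0}"
    using assms by (intro form_ker_coercive) (auto simp: fixed_conditions_def symmetric_bilinear_def)
  show "symmetric_bilinear a" "symmetric_bilinear (pencil b c t)"
    "continuous_on UNIV (\<lambda>(u, v). a u v)" "weakly_seq_continuous (pencil b c t)"
    using assms
    by (auto simp: fixed_conditions_def symmetric_bilinear_pencil weakly_seq_continuous_pencil)
  show "edim (form_ker a) < \<infinity>" by (simp add: ker edim_zero)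
  show "pencil b c t u u < 0" if "u \<in> form_ker a" "u \<noteq> 0" for u
    using that ker by simp
  show "coercive_on {u. \<forall>w\<in>form_ker a. pencil b c t u w = 0} a"
    using assms(1) by (auto simp: fixed_conditions_def coercive_on_def)
qed

text \<open>On the finite-dimensional kernel of \<open>a\<close> the form \<open>c\<close> is
  positive definite, hence coercive, so \<open>t c\<close> dominates \<open>b\<close> there for
  large \<open>t\<close>. A vector that is \<open>f\<close>-orthogonal to the kernel then has its
  kernel component controlled by its orthogonal component, where \<open>a\<close> is
  coercive.\<close>

lemma moving_coercive_pencil:
  fixes a b c :: "'a::{real_inner,complete_space} \<Rightarrow> 'a \<Rightarrow> real"
  assumes moving: "moving_conditions a b c"
    and forms: "symmetric_bilinear a" "symmetric_bilinear b" "symmetric_bilinear c"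
    and c_nonneg: "\<And>u. 0 \<le> c u u"
  shows "\<forall>\<^sub>F t in at_top. coercive_pencil a (pencil b c t)"
proof -
  have cont: "continuous_on UNIV (\<lambda>(u, v). a u v)" "weakly_seq_continuous b" "weakly_seq_continuous c"
    and ker_c: "form_ker a \<inter> form_ker c = {0}"
    and ker_finite: "edim (form_ker a) < \<infinity>"
    using moving by (auto simp: moving_conditions_def)
  obtain \<gamma> where \<gamma>: "\<gamma> > 0" "\<And>u. u \<in> orthogonal_comp (form_ker a) \<Longrightarrow> \<gamma> * (norm u)\<^sup>2 \<le> a u u"
    using moving by (auto simp: moving_conditions_def coercive_on_def)
  have bil: "bilinear a" "bilinear b" "bilinear c" and sym_a: "\<And>u v. a u v = a v u"
    using forms by (auto simp: symmetric_bilinear_def)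
  obtain T where T: "finite T" "span T = form_ker a"
    using finite_edim_basis[OF subspace_form_ker[OF bil(1)] ker_finite] by metis
  have "0 < c u u" if "u \<in> span T" "u \<noteq> 0" for u
    using nonneg_form_ker[OF forms(3) c_nonneg, of u] c_nonneg[of u] that T ker_c
    by (cases "c u u = 0") auto
  then have "coercive_on (span T) c"
    by (rule coercive_on_span_of_finite[OF bil(3) cont(3) T(1)])
  then obtain \<delta> where \<delta>: "\<delta> > 0" "\<And>u. u \<in> form_ker a \<Longrightarrow> \<delta> * (norm u)\<^sup>2 \<le> c u u"
    using T(2) by (auto simp: coercive_on_def)
  obtain Mb where Mb: "Mb > 0" "\<And>u v. \<bar>b u v\<bar> \<le> Mb * norm u * norm v"
    using weakly_seq_continuous_bilinear_bounded[OF bil(2) cont(2)] by blast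
  \<comment> \<open>The summand 1 beyond the bound \<open>Mb\<close> of \<open>b\<close> leaves
    \<open>f k k \<le> - (norm k)\<^sup>2\<close> on the kernel.\<close>
  have "coercive_pencil a (pencil b c t)" if t: "t \<ge> (Mb + 1) / \<delta>" for t
  proof
    let ?f = "pencil b c t"
    show "symmetric_bilinear a" "continuous_on UNIV (\<lambda>(u, v). a u v)" "edim (form_ker a) < \<infinity>"
      by fact+
    show f_form: "symmetric_bilinear ?f" by (rule symmetric_bilinear_pencil[OF forms(2,3)])
    show f_cont: "weakly_seq_continuous ?f" by (rule weakly_seq_continuous_pencil[OF cont(2,3)])
    have f_bil: "bilinear ?f" using f_form by (simp add: symmetric_bilinear_def)
    have "0 < (Mb + 1) / \<delta>" using Mb(1) \<delta>(1) by simp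
    then have "t \<ge> 0" using t by linarith
    have f_neg: "(norm k)\<^sup>2 \<le> - ?f k k" if "k \<in> form_ker a" for k
    proof -
      have "Mb + 1 \<le> t * \<delta>" using t \<delta>(1) by (simp add: divide_le_eq)
      then have "(Mb + 1) * (norm k)\<^sup>2 \<le> (t * \<delta>) * (norm k)\<^sup>2" by (rule mult_right_mono) simp
      also have "\<dots> \<le> t * c k k"
        using mult_left_mono[OF \<delta>(2)[OF that] \<open>t \<ge> 0\<close>] by (simp add: mult.assoc)
      finally have "(Mb + 1) * (norm k)\<^sup>2 \<le> t * c k k" .
      moreover have "b k k \<le> Mb * (norm k)\<^sup>2"
        using Mb(2)[of k k] by (simp add: power2_eq_square mult.assoc)
      ultimately show ?thesis by (simp add: pencil_def algebra_simps)
    qed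
    show "?f u u < 0" if "u \<in> form_ker a" "u \<noteq> 0" for u
    proof -
      have "0 < (norm u)\<^sup>2" using that(2) by simp
      then show ?thesis using f_neg[OF that(1)] by linarith
    qed
    obtain M where M: "M > 0" "\<And>u v. \<bar>?f u v\<bar> \<le> M * norm u * norm v"
      using weakly_seq_continuous_bilinear_bounded[OF f_bil f_cont] by blast
    \<comment> \<open>The factor comes from \<open>norm u \<le> (1 + M) * norm p\<close>, where
      \<open>p\<close> is the component of \<open>u\<close> orthogonal to the kernel of
      \<open>a\<close>; the kernel component \<open>k\<close> does not change
      \<open>a u u\<close>.\<close>
    have "\<gamma> / (1 + M)\<^sup>2 * (norm u)\<^sup>2 \<le> a u u" if u: "\<forall>w\<in>form_ker a. ?f u w = 0" for u
    proof -
      have "bilinear (\<lambda>u v :: 'a. u \<bullet> v)"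
        by (auto simp: bilinear_def inner_add intro!: linearI)
      then obtain k where k: "k \<in> form_ker a" "\<And>x. x \<in> form_ker a \<Longrightarrow> (u - k) \<bullet> x = 0"
        using form_projection_onto_span[of "\<lambda>u v. u \<bullet> v" T u] T by auto
      define p where "p = u - k"
      have p: "u = k + p" by (simp add: p_def)
      have "p \<in> orthogonal_comp (form_ker a)"
        using k(2) by (auto simp: orthogonal_comp_def orthogonal_def p_def inner_commute)
      then have "\<gamma> * (norm p)\<^sup>2 \<le> a p p" by (rule \<gamma>(2))
      also have "a p p = a u u"
        using k(1) sym_a[of p k] by (simp add: p form_ker_def bilinear_ladd[OF bil(1)] bilinear_radd[OF bil(1)])
      finally have ap: "\<gamma> * (norm p)\<^sup>2 \<le> a u u" .
      \<comment> \<open>Testing the \<open>f\<close>-orthogonality of \<open>u\<close> with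
        \<open>k\<close> itself bounds \<open>norm k\<close> by \<open>M * norm p\<close>.\<close>
      have "?f k k + ?f p k = 0" using u k(1) by (simp add: p bilinear_ladd[OF f_bil])
      then have "(norm k)\<^sup>2 \<le> ?f p k" using f_neg[OF k(1)] by simp
      also have "\<dots> \<le> M * norm p * norm k" using M(2)[of p k] by simp
      finally have "norm k * norm k \<le> (M * norm p) * norm k" by (simp add: power2_eq_square)
      then have "norm k \<le> M * norm p"
        using M(1) by (cases "k = 0") (auto simp: mult_le_cancel_right)
      then have "norm u \<le> (1 + M) * norm p"
        using norm_triangle_ineq[of k p] by (simp add: p algebra_simps)
      then have "(norm u)\<^sup>2 \<le> ((1 + M) * norm p)\<^sup>2" by (rule power_mono) simp
      then have "(norm u)\<^sup>2 / (1 + M)\<^sup>2 \<le> (norm p)\<^sup>2"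
        using M(1) by (simp add: power_mult_distrib divide_le_eq mult.commute)
      then have "\<gamma> * ((norm u)\<^sup>2 / (1 + M)\<^sup>2) \<le> \<gamma> * (norm p)\<^sup>2"
        using \<gamma>(1) by (intro mult_left_mono) auto
      then show ?thesis using ap by simp
    qed
    moreover have "0 < \<gamma> / (1 + M)\<^sup>2" using \<gamma>(1) M(1) by simp
    ultimately show "coercive_on {u. \<forall>w\<in>form_ker a. ?f u w = 0} a"
      unfolding coercive_on_def by blast
  qed
  then show ?thesis by (rule eventually_at_top_linorderI)
qed

text \<open>The pencil is affine in \<open>t\<close>, so vanishing at the two parameters
  \<open>s + 1\<close> and \<open>s + 2\<close> kills both coefficients.\<close>

lemma limit_space_eq:
  "limit_space a b c = {u. \<forall>w\<in>form_ker a. b u w = 0 \<and> c u w = 0}"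
proof (intro set_eqI iffI)
  fix u assume "u \<in> limit_space a b c"
  then obtain s where s: "\<And>t. t > s \<Longrightarrow> u \<in> moving_space a b c t"
    by (auto simp: limit_space_def)
  have "b u w = 0 \<and> c u w = 0" if "w \<in> form_ker a" for w
    using s[of "s + 1"] s[of "s + 2"] that by (simp add: moving_space_def pencil_def algebra_simps)
  then show "u \<in> {u. \<forall>w\<in>form_ker a. b u w = 0 \<and> c u w = 0}" by blast
qed (auto simp: limit_space_def moving_space_def pencil_def)

section \<open>Existence, limit and monotonicity of the eigenvalues\<close>

lemma neg_eigenvalue_eventually_ge:
  fixes a b c :: "'a::{real_inner,complete_space} \<Rightarrow> 'a \<Rightarrow> real"
  assumes moving: "moving_conditions a b c"
    and forms: "symmetric_bilinear a" "symmetric_bilinear b" "symmetric_bilinear c"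
    and c_nonneg: "\<And>u. 0 \<le> c u u"
    and j: "1 \<le> j" "enat j \<le> codim_in (limit_space a b c) (form_ker c \<inter> limit_space a b c)"
    and "\<epsilon> > 0"
  shows "\<forall>\<^sub>F t in at_top. \<exists>\<nu>\<ge>-\<epsilon>. is_neg_eigenvalue a (pencil b c t) j \<nu>"
proof -
  have cont: "continuous_on UNIV (\<lambda>(u, v). a u v)" "weakly_seq_continuous b" "weakly_seq_continuous c"
    using moving by (auto simp: moving_conditions_def)
  have bil: "bilinear a" "bilinear b" "bilinear c"
    using forms by (auto simp: symmetric_bilinear_def)
  define L where "L = limit_space a b c"
  have "subspace L"
    unfolding L_def limit_space_eq
    using bil by (auto simp: subspace_def bilinear_lzero bilinear_ladd bilinear_lmul)
  have "{} \<in> {B. finite B \<and> B \<subseteq> L \<and> independent_mod (form_ker c \<inter> L) B}"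
    by (simp add: independent_mod_def)
  then obtain B where B: "finite B" "B \<subseteq> L" "independent_mod (form_ker c \<inter> L) B" "j \<le> card B"
    using enat_le_SUP_attained[OF _ j(2)[folded L_def, unfolded codim_in_def]]
    by (metis (mono_tags, lifting) empty_iff mem_Collect_eq)
  have "span B \<subseteq> L" using B(2) \<open>subspace L\<close> by (rule span_minimal)
  have zero: "0 \<in> form_ker c \<inter> L"
    using subspace_0[OF \<open>subspace L\<close>] subspace_0[OF subspace_form_ker[OF bil(3)]] by simp
  have "independent B"
    using B(1,3) zero unfolding independent_mod_def dependent_finite[OF B(1)] by metis
  \<comment> \<open>A vector of \<open>span B\<close> with \<open>c u u = 0\<close> would lie in the
    kernel of \<open>c\<close>, and independence modulo the kernel then annihilates its
    coefficients.\<close>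
  have "0 < c u u" if u: "u \<in> span B" "u \<noteq> 0" for u
  proof (rule ccontr)
    assume "\<not> 0 < c u u"
    then have "u \<in> form_ker c" using c_nonneg[of u] by (intro nonneg_form_ker[OF forms(3) c_nonneg]) simp
    moreover obtain k where k: "u = (\<Sum>x\<in>B. k x *\<^sub>R x)"
      using u(1) span_finite[OF B(1)] by auto
    ultimately have "\<forall>x\<in>B. k x = 0"
      using B(3) u(1) \<open>span B \<subseteq> L\<close> unfolding independent_mod_def by blast
    then show False using k u(2) by simp
  qed
  then have "coercive_on (span B) c"
    by (rule coercive_on_span_of_finite[OF bil(3) cont(3) B(1)])
  then obtain \<delta> where \<delta>: "\<delta> > 0" "\<And>u. u \<in> span B \<Longrightarrow> \<delta> * (norm u)\<^sup>2 \<le> c u u"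
    by (auto simp: coercive_on_def)
  obtain Ma where Ma: "Ma > 0" "\<And>u v. \<bar>a u v\<bar> \<le> Ma * norm u * norm v"
    using continuous_bilinear_bounded[OF bil(1) cont(1)] by blast
  obtain Mb where Mb: "Mb > 0" "\<And>u v. \<bar>b u v\<bar> \<le> Mb * norm u * norm v"
    using weakly_seq_continuous_bilinear_bounded[OF bil(2) cont(2)] by blast
  \<comment> \<open>The threshold for \<open>t\<close> makes \<open>- pencil b c t u u\<close> at
    least \<open>Ma / \<epsilon> * (norm u)\<^sup>2\<close> on \<open>span B\<close>; multiplied by
    \<open>\<epsilon>\<close> this dominates \<open>a u u\<close>.\<close>
  have ge: "\<exists>\<nu>\<ge>-\<epsilon>. is_neg_eigenvalue a (pencil b c t) j \<nu>"
    if t: "coercive_pencil a (pencil b c t)" "t \<ge> (Ma / \<epsilon> + Mb) / \<delta>" for t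
  proof -
    interpret coercive_pencil a "pencil b c t" by (rule t(1))
    have "0 < (Ma / \<epsilon> + Mb) / \<delta>" using Ma(1) Mb(1) \<delta>(1) \<open>\<epsilon> > 0\<close> by (simp add: add_pos_pos)
    then have "t \<ge> 0" using t(2) by linarith
    have "span B \<subseteq> S"
      using \<open>span B \<subseteq> L\<close> unfolding S_def by (auto simp: L_def limit_space_eq pencil_def)
    moreover have "a u u \<le> (- \<epsilon>) * pencil b c t u u" if "u \<in> span B" for u
    proof -
      have "Ma / \<epsilon> + Mb \<le> t * \<delta>" using t(2) \<delta>(1) by (simp add: divide_le_eq)
      then have "(Ma / \<epsilon> + Mb) * (norm u)\<^sup>2 \<le> (t * \<delta>) * (norm u)\<^sup>2" by (rule mult_right_mono) simp
      also have "\<dots> \<le> t * c u u"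
        using mult_left_mono[OF \<delta>(2)[OF that] \<open>t \<ge> 0\<close>] by (simp add: mult.assoc)
      finally have "(Ma / \<epsilon> + Mb) * (norm u)\<^sup>2 - Mb * (norm u)\<^sup>2 \<le> t * c u u - b u u"
        using Mb(2)[of u u] by (simp add: power2_eq_square mult.assoc)
      then have "Ma / \<epsilon> * (norm u)\<^sup>2 \<le> - pencil b c t u u"
        by (simp add: pencil_def algebra_simps)
      then have "\<epsilon> * (Ma / \<epsilon> * (norm u)\<^sup>2) \<le> \<epsilon> * (- pencil b c t u u)"
        using \<open>\<epsilon> > 0\<close> by (intro mult_left_mono) auto
      moreover have "a u u \<le> Ma * (norm u)\<^sup>2"
        using Ma(2)[of u u] by (simp add: power2_eq_square mult.assoc)
      ultimately show ?thesis using \<open>\<epsilon> > 0\<close> by simp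
    qed
    moreover have "- \<epsilon> < 0" using \<open>\<epsilon> > 0\<close> by simp
    ultimately obtain \<nu> where "- \<epsilon> \<le> \<nu>" "is_neg_eigenvalue a (pencil b c t) j \<nu>"
      using neg_eigenvalue_ge_if_form_le[OF _ j(1) B(4,1) \<open>independent B\<close>] by blast
    then show ?thesis by blast
  qed
  show ?thesis
    using moving_coercive_pencil[OF moving forms c_nonneg]
      eventually_ge_at_top[of "(Ma / \<epsilon> + Mb) / \<delta>"]
    by eventually_elim (rule ge)
qed

lemma moving_neg_eigenvalue_limit:
  fixes a b c :: "'a::{real_inner,complete_space} \<Rightarrow> 'a \<Rightarrow> real"
  assumes "moving_conditions a b c"
    and "symmetric_bilinear a" "symmetric_bilinear b" "symmetric_bilinear c"
    and "\<And>u. 0 \<le> c u u"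
    and "1 \<le> j" "enat j \<le> codim_in (limit_space a b c) (form_ker c \<inter> limit_space a b c)"
  shows "\<forall>\<^sub>F t in at_top. neg_eigenvalue_exists a (pencil b c t) j"
    and "((\<lambda>t. neg_eigenvalue a (pencil b c t) j) \<longlongrightarrow> 0) at_top"
proof -
  note ge = neg_eigenvalue_eventually_ge[OF assms]
  show "\<forall>\<^sub>F t in at_top. neg_eigenvalue_exists a (pencil b c t) j"
    using ge[of 1] by (auto simp: neg_eigenvalue_exists_def elim: eventually_mono)
  show "((\<lambda>t. neg_eigenvalue a (pencil b c t) j) \<longlongrightarrow> 0) at_top"
  proof (rule tendstoI)
    \<comment> \<open>Using \<open>e/2\<close> turns the weak lower bound into the strict inequality
      required.\<close>
    fix e :: real assume "e > 0"
    then have "\<forall>\<^sub>F t in at_top. \<exists>\<nu>\<ge>-(e/2). is_neg_eigenvalue a (pencil b c t) j \<nu>"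
      by (intro ge) simp
    then show "\<forall>\<^sub>F t in at_top. dist (neg_eigenvalue a (pencil b c t) j) 0 < e"
    proof eventually_elim
      case (elim t)
      then obtain \<nu> where \<nu>: "\<nu> \<ge> -(e/2)" "is_neg_eigenvalue a (pencil b c t) j \<nu>" by blast
      then have "neg_eigenvalue a (pencil b c t) j = \<nu>" "\<nu> < 0"
        by (auto simp: neg_eigenvalue_eq is_neg_eigenvalue_def)
      then show ?case using \<nu>(1) \<open>e > 0\<close> by simp
    qed
  qed
qed

text \<open>Since the kernel of \<open>a\<close> is trivial, \<open>S\<close> is the whole space for
  every parameter, so a test subspace found at \<open>s\<close> stays admissible at
  \<open>t\<close>. The pencil decreases in \<open>t\<close> and \<open>\<mu>\<close> is negative,
  so the test inequality persists as well.\<close>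

lemma fixed_neg_eigenvalue_mono:
  fixes a b c :: "'a::{real_inner,complete_space} \<Rightarrow> 'a \<Rightarrow> real"
  assumes fixed: "fixed_conditions a b c"
    and forms: "symmetric_bilinear a" "symmetric_bilinear b" "symmetric_bilinear c"
    and c_nonneg: "\<And>u. 0 \<le> c u u" and "1 \<le> j"
  shows "mono_on {t. neg_eigenvalue_exists a (pencil b c t) j}
           (\<lambda>t. neg_eigenvalue a (pencil b c t) j)"
proof (rule mono_onI)
  fix s t :: real
  assume "s \<in> {t. neg_eigenvalue_exists a (pencil b c t) j}"
    and "t \<in> {t. neg_eigenvalue_exists a (pencil b c t) j}" and "s \<le> t"
  then obtain \<mu> where \<mu>: "is_neg_eigenvalue a (pencil b c s) j \<mu>"
    by (auto simp: neg_eigenvalue_exists_def)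
  interpret s: coercive_pencil a "pencil b c s" by (rule fixed_coercive_pencil[OF fixed forms])
  interpret t: coercive_pencil a "pencil b c t" by (rule fixed_coercive_pencil[OF fixed forms])
  have "\<mu> < 0" using \<mu> by (simp add: is_neg_eigenvalue_def)
  obtain B where B: "finite B" "independent B" "card B = j"
      and le: "\<And>u. u \<in> span B \<Longrightarrow> a u u \<le> \<mu> * pencil b c s u u"
    using s.neg_eigenvalueD[OF \<mu>] by metis
  have "form_ker a = {0}"
    using fixed s.bil(1) by (intro form_ker_coercive) (auto simp: fixed_conditions_def)
  then have "t.S = UNIV" by (simp add: t.S_def t.bil_simps)
  moreover have "a u u \<le> \<mu> * pencil b c t u u" if "u \<in> span B" for u
  proof -
    have "pencil b c t u u \<le> pencil b c s u u"
      using \<open>s \<le> t\<close> c_nonneg[of u] by (simp add: pencil_def mult_right_mono)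
    then have "\<mu> * pencil b c s u u \<le> \<mu> * pencil b c t u u"
      using \<open>\<mu> < 0\<close> by (intro mult_left_mono_neg) auto
    with le[OF that] show ?thesis by (rule order_trans)
  qed
  ultimately obtain \<nu> where "\<mu> \<le> \<nu>" "is_neg_eigenvalue a (pencil b c t) j \<nu>"
    using t.neg_eigenvalue_ge_if_form_le[OF \<open>\<mu> < 0\<close> \<open>1 \<le> j\<close> _ B(1,2)] B(3)
    by (metis order_refl subset_UNIV)
  then show "neg_eigenvalue a (pencil b c s) j \<le> neg_eigenvalue a (pencil b c t) j"
    using \<mu> by (simp add: neg_eigenvalue_eq)
qed

theorem proposition2p4:
  fixes a b c :: "'a::{real_inner, complete_space} \<Rightarrow> 'a \<Rightarrow> real"
  assumes "symmetric_bilinear a" and "symmetric_bilinear b" and "symmetric_bilinear c"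
    and "\<forall>u. 0 \<le> c u u" and "\<exists>u. c u u \<noteq> 0"
  shows
    "(fixed_conditions a b c \<longrightarrow>
       (\<forall>j::nat. 1 \<le> j \<and> enat j \<le> codim_in UNIV (form_ker c) \<longrightarrow>
          (\<forall>\<^sub>F t in at_top. neg_eigenvalue_exists a (pencil b c t) j) \<and>
          mono_on {t. neg_eigenvalue_exists a (pencil b c t) j}
            (\<lambda>t. neg_eigenvalue a (pencil b c t) j) \<and>
          ((\<lambda>t. neg_eigenvalue a (pencil b c t) j) \<longlongrightarrow> 0) at_top)) \<and>
     (moving_conditions a b c \<longrightarrow>
       (\<forall>j::nat. 1 \<le> j \<and>
            enat j \<le> codim_in (limit_space a b c) (form_ker c \<inter> limit_space a b c) \<longrightarrow>
          (\<forall>\<^sub>F t in at_top. neg_eigenvalue_exists a (pencil b c t) j) \<and>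
          ((\<lambda>t. neg_eigenvalue a (pencil b c t) j) \<longlongrightarrow> 0) at_top))"
proof (intro conjI impI allI; (elim conjE)?)
  fix j :: nat
  assume fixed: "fixed_conditions a b c" and j: "1 \<le> j" "enat j \<le> codim_in UNIV (form_ker c)"
  have bil: "bilinear a" "bilinear b" "bilinear c"
    using assms by (auto simp: symmetric_bilinear_def)
  have "form_ker a = {0}"
    using fixed bil(1) by (intro form_ker_coercive) (auto simp: fixed_conditions_def)
  \<comment> \<open>With trivial kernel the orthogonality conditions are void, so the codimension of
    the moving case becomes that of \<open>form_ker c\<close> in the whole space.\<close>
  then have "limit_space a b c = UNIV"
    by (simp add: limit_space_eq bilinear_rzero[OF bil(2)] bilinear_rzero[OF bil(3)])
  then have codim: "enat j \<le> codim_in (limit_space a b c) (form_ker c \<inter> limit_space a b c)"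
    using j(2) by simp
  note moving = fixed_imp_moving[OF fixed assms(1,3)]
  show "\<forall>\<^sub>F t in at_top. neg_eigenvalue_exists a (pencil b c t) j"
    "((\<lambda>t. neg_eigenvalue a (pencil b c t) j) \<longlongrightarrow> 0) at_top"
    using assms(4) by (intro moving_neg_eigenvalue_limit[OF moving assms(1-3) _ j(1) codim]; simp)+
  show "mono_on {t. neg_eigenvalue_exists a (pencil b c t) j}
     (\<lambda>t. neg_eigenvalue a (pencil b c t) j)"
    using assms(4) by (intro fixed_neg_eigenvalue_mono[OF fixed assms(1-3) _ j(1)]) simp
next
  fix j :: nat
  assume moving: "moving_conditions a b c" and j: "1 \<le> j"
    "enat j \<le> codim_in (limit_space a b c) (form_ker c \<inter> limit_space a b c)"
  show "\<forall>\<^sub>F t in at_top. neg_eigenvalue_exists a (pencil b c t) j"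
    "((\<lambda>t. neg_eigenvalue a (pencil b c t) j) \<longlongrightarrow> 0) at_top"
    using assms(4) by (intro moving_neg_eigenvalue_limit[OF moving assms(1-3) _ j]; simp)+
qed

end
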